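(* Let $p$ be a prime and let $\mathcal{F}$ be a saturated fusion system on a finite $p$-group $S$. Let $\mathcal{H}$ be a saturated fusion subsystem of $\mathcal{F}$ on $S$, and let $\mathcal{K}$ be a saturated fusion subsystem of $\mathcal{F}$ on a subgroup $T\le S$. If \[ \omega_{\mathcal{F}} \circ [T,\mathrm{incl}]_T^S = \omega_{\mathcal{H}} \circ [T,\mathrm{incl}]_T^S \circ \omega_{\mathcal{K}} \] in $A(T,S)_{(p)}$, then ${}_{S}\mathcal{F}_T = \mathcal{H}\mathcal{K}$ (that is, $\mathcal{F}$ is the composition product of $\mathcal{H}$ and $\mathcal{K}$).
   Context: Fusion systems and saturation are in the standard sense of Broto--Levi--Oliver. A fusion subsystem of $\mathcal{F}$ on a subgroup $R\le S$ is a fusion system on $R$ all of whose morphisms are morphisms of $\mathcal{F}$. Composition product. Let $\mathcal{H},\mathcal{K}$ be fusion subsystems of $\mathcal{F}$ on subgroups $R,T\le S$. Write ${}_R\mathcal{F}_T=\mathcal{H}\mathcal{K}$ if $S=RT$ and every morphism $\varphi\colon P\to Q$ in $\mathcal{F}$ with $P\le T$ and $Q\le R$ can be written as $\varphi=\eta\circ\kappa$ with $\kappa$ in $\mathcal{K}$ and $\eta$ in $\mathcal{H}$. Here $R=S$. Burnside modules. For finite groups $G,H$, a $(G,H)$-biset is a set with commuting left $H$-action and right $G$-action. $A(G,H)$ is the Grothendieck group (under disjoint union) of isomorphism classes of finite $(G,H)$-bisets whose left $H$-action is free; $A(G,H)_{(p)}$ is its $p$-localization. For $K\le G$ and a homomorphism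 $\varphi\colon K\to H$, $[K,\varphi]_G^H$ (or $[K,\varphi]$) is the class of $H\times_{K,\varphi}G=(H\times G)/\sim$, where $(h,kg)\sim(h\varphi(k),g)$ for $k\in K$. These classes, over conjugacy classes of pairs $(K,\varphi)$ (conjugacy in both $G$ and $H$), form a basis of $A(G,H)$. The bilinear composition $A(H,K)\times A(G,H)\to A(G,K)$ is given on bisets by $X\circ Y=X\times_H Y$. The map $\mathrm{incl}$ denotes the relevant inclusion of subgroups. Characteristic idempotents. Let $\mathcal{F}$ be a fusion system on $S$. An element $X\in A(S,S)_{(p)}$ is $\mathcal{F}$-generated if it is a linear combination of basis elements $[P,\varphi]$ with $\varphi$ in $\mathcal{F}$. For a finite group $H$, $X\in A(S,H)_{(p)}$ is right $\mathcal{F}$-stable if $X\circ[P,\varphi]_P^S=X\circ[P,\mathrm{incl}]_P^S$ for all $P\le S$, $\varphi\in\mathrm{Hom}_{\mathcal{F}}(P,S)$; $X\in A(H,S)_{(p)}$ is left $\mathcal{F}$-stable if $[\varphi(P),\varphi^{-1}]_S^P\circ X=[P,\mathrm{id}]_S^P\circ X$ for all such $P,\varphi$. The augmentation $\epsilon\colon A(S,S)_{(p)}\to\mathbb{Z}_{(p)}$ is the linear map with $\epsilon([P,\varphi]_S^S)=|S/P|$. For $\mathcal{F}$ saturated, a characteristic idempotent for $\mathcal{F}$ is an idempotent of the ring $A(S,S)_{(p)}$ that is $\mathcal{F}$-generated, left and right $\mathcal{F}$-stable, and of augmentation prime to $p$. It is known that every saturated fusion system $\mathcal{F}$ has exactly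 one characteristic idempotent; it is denoted $\omega_{\mathcal{F}}$. *)

theory Defs
  imports
    Complex_Main
    "HOL-Algebra.Group_Action"
    "HOL-Computational_Algebra.Primes"
    "HOL-Library.Poly_Mapping"
begin

section \<open>Fusion systems\<close>

definition finite_p_group :: "nat \<Rightarrow> 'a monoid \<Rightarrow> bool" where
  "finite_p_group p S \<longleftrightarrow> group S \<and> finite (carrier S) \<and> (\<exists>n. order S = p ^ n)"

definition conj_map :: "'a monoid \<Rightarrow> 'a \<Rightarrow> 'a set \<Rightarrow> 'a \<Rightarrow> 'a" where
  "conj_map S g P = (\<lambda>x\<in>P. g \<otimes>\<^bsub>S\<^esub> x \<otimes>\<^bsub>S\<^esub> inv\<^bsub>S\<^esub> g)"

definition Hom_grp :: "'a monoid \<Rightarrow> 'a set \<Rightarrow> 'a set \<Rightarrow> ('a \<Rightarrow> 'a) set" where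
  "Hom_grp S P Q = {conj_map S g P | g. g \<in> carrier S \<and> conj_map S g P ` P \<subseteq> Q}"

definition Inj :: "'a monoid \<Rightarrow> 'a set \<Rightarrow> 'a set \<Rightarrow> ('a \<Rightarrow> 'a) set" where
  "Inj S P Q = {\<phi> \<in> hom (S\<lparr>carrier := P\<rparr>) (S\<lparr>carrier := Q\<rparr>). \<phi> \<in> extensional P \<and> inj_on \<phi> P}"

text \<open>
  A category whose objects are the subgroups of a group is given by its morphism sets. A morphism
  from \<open>P\<close> to \<open>Q\<close> is stored as a function that is undefined outside \<open>P\<close>, so equality of functions
  is equality of maps. Only the values at subgroups are relevant.
\<close>

type_synonym 'a hom_sets = "'a set \<Rightarrow> 'a set \<Rightarrow> ('a \<Rightarrow> 'a) set"

definition cat_iso :: "'a hom_sets \<Rightarrow> 'a set \<Rightarrow> 'a set \<Rightarrow> ('a \<Rightarrow> 'a) \<Rightarrow> bool" where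
  "cat_iso F P Q \<phi> \<longleftrightarrow> \<phi> \<in> F P Q \<and>
     (\<exists>\<psi>\<in>F Q P. compose P \<psi> \<phi> = (\<lambda>x\<in>P. x) \<and> compose Q \<phi> \<psi> = (\<lambda>x\<in>Q. x))"

text \<open>
  Identities are morphisms because they lie in \<open>Hom_grp S P P\<close>. In the last clause \<open>R\<close> is the
  intermediate object of a factorization into an isomorphism followed by the inclusion into \<open>Q\<close>.
\<close>

definition fusion_system :: "'a monoid \<Rightarrow> 'a hom_sets \<Rightarrow> bool" where
  "fusion_system S F \<longleftrightarrow>
     (\<forall>P Q. subgroup P S \<longrightarrow> subgroup Q S \<longrightarrow> Hom_grp S P Q \<subseteq> F P Q \<and> F P Q \<subseteq> Inj S P Q) \<and>
     (\<forall>P Q R \<phi> \<psi>. subgroup P S \<longrightarrow> subgroup Q S \<longrightarrow> subgroup R S \<longrightarrow>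
        \<phi> \<in> F P Q \<longrightarrow> \<psi> \<in> F Q R \<longrightarrow> compose P \<psi> \<phi> \<in> F P R) \<and>
     (\<forall>P Q \<phi>. subgroup P S \<longrightarrow> subgroup Q S \<longrightarrow> \<phi> \<in> F P Q \<longrightarrow>
        (\<exists>R \<alpha>. subgroup R S \<and> R \<subseteq> Q \<and> cat_iso F P R \<alpha> \<and> \<phi> = compose P (\<lambda>x\<in>R. x) \<alpha>))"

definition fusion_conjugate :: "'a monoid \<Rightarrow> 'a hom_sets \<Rightarrow> 'a set \<Rightarrow> 'a set \<Rightarrow> bool" where
  "fusion_conjugate S F P Q \<longleftrightarrow> subgroup P S \<and> subgroup Q S \<and> (\<exists>\<phi>. cat_iso F P Q \<phi>)"

definition centralizer :: "'a monoid \<Rightarrow> 'a set \<Rightarrow> 'a set" where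
  "centralizer S P = {g \<in> carrier S. \<forall>x\<in>P. g \<otimes>\<^bsub>S\<^esub> x = x \<otimes>\<^bsub>S\<^esub> g}"

definition fully_centralized :: "'a monoid \<Rightarrow> 'a hom_sets \<Rightarrow> 'a set \<Rightarrow> bool" where
  "fully_centralized S F P \<longleftrightarrow> subgroup P S \<and>
     (\<forall>Q. fusion_conjugate S F P Q \<longrightarrow> card (centralizer S Q) \<le> card (centralizer S P))"

definition fully_normalized :: "'a monoid \<Rightarrow> 'a hom_sets \<Rightarrow> 'a set \<Rightarrow> bool" where
  "fully_normalized S F P \<longleftrightarrow> subgroup P S \<and>
     (\<forall>Q. fusion_conjugate S F P Q \<longrightarrow> card (normalizer S Q) \<le> card (normalizer S P))"

definition Aut_fusion :: "'a hom_sets \<Rightarrow> 'a set \<Rightarrow> ('a \<Rightarrow> 'a) monoid" where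
  "Aut_fusion F P = \<lparr>carrier = {\<phi>. cat_iso F P P \<phi>}, monoid.mult = compose P, one = (\<lambda>x\<in>P. x)\<rparr>"

definition sylow_subgroup :: "nat \<Rightarrow> 'a set \<Rightarrow> 'a monoid \<Rightarrow> bool" where
  "sylow_subgroup p A G \<longleftrightarrow> subgroup A G \<and> card A = p ^ multiplicity p (order G)"

definition extension_domain :: "'a monoid \<Rightarrow> 'a set \<Rightarrow> ('a \<Rightarrow> 'a) \<Rightarrow> 'a set" where
  "extension_domain S P \<phi> = {g \<in> normalizer S P.
     compose (\<phi> ` P) \<phi> (compose (\<phi> ` P) (conj_map S g P) (\<lambda>y\<in>\<phi> ` P. inv_into P \<phi> y))
       \<in> Hom_grp S (\<phi> ` P) (\<phi> ` P)}"

definition saturated_fusion_system :: "nat \<Rightarrow> 'a monoid \<Rightarrow> 'a hom_sets \<Rightarrow> bool" where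
  "saturated_fusion_system p S F \<longleftrightarrow> fusion_system S F \<and>
     (\<forall>P. fully_normalized S F P \<longrightarrow>
        fully_centralized S F P \<and> sylow_subgroup p (Hom_grp S P P) (Aut_fusion F P)) \<and>
     (\<forall>P \<phi>. subgroup P S \<longrightarrow> \<phi> \<in> F P (carrier S) \<longrightarrow> fully_centralized S F (\<phi> ` P) \<longrightarrow>
        (\<exists>\<psi>\<in>F (extension_domain S P \<phi>) (carrier S). restrict \<psi> P = \<phi>))"

definition fusion_subsystem :: "'a monoid \<Rightarrow> 'a hom_sets \<Rightarrow> 'a set \<Rightarrow> 'a hom_sets \<Rightarrow> bool" where
  "fusion_subsystem S F R H \<longleftrightarrow> subgroup R S \<and> fusion_system (S\<lparr>carrier := R\<rparr>) H \<and>
     (\<forall>P Q. subgroup P (S\<lparr>carrier := R\<rparr>) \<longrightarrow> subgroup Q (S\<lparr>carrier := R\<rparr>) \<longrightarrow> H P Q \<subseteq> F P Q)"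

text \<open>
  The intermediate object \<open>U\<close> is the target of \<open>\<kappa>\<close> and the source of \<open>\<eta>\<close>, hence an object of both
  subsystems.
\<close>

definition composition_product ::
  "'a monoid \<Rightarrow> 'a hom_sets \<Rightarrow> 'a set \<Rightarrow> 'a hom_sets \<Rightarrow> 'a set \<Rightarrow> 'a hom_sets \<Rightarrow> bool" where
  "composition_product S F R H T K \<longleftrightarrow> carrier S = R <#>\<^bsub>S\<^esub> T \<and>
     (\<forall>P Q \<phi>. subgroup P (S\<lparr>carrier := T\<rparr>) \<longrightarrow> subgroup Q (S\<lparr>carrier := R\<rparr>) \<longrightarrow> \<phi> \<in> F P Q \<longrightarrow>
        (\<exists>U \<kappa> \<eta>. subgroup U (S\<lparr>carrier := T\<rparr>) \<and> subgroup U (S\<lparr>carrier := R\<rparr>) \<and>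
           \<kappa> \<in> K P U \<and> \<eta> \<in> H U Q \<and> \<phi> = compose P \<eta> \<kappa>))"


section \<open>Bisets\<close>

record ('g, 'h, 'x) biset =
  points :: "'x set"
  lact :: "'h \<Rightarrow> 'x \<Rightarrow> 'x"
  ract :: "'x \<Rightarrow> 'g \<Rightarrow> 'x"

text \<open>
  Finite \<open>(G, H)\<close>-bisets, with \<open>H\<close> acting freely on the left and \<open>G\<close> acting on the right.
\<close>

definition left_free_biset :: "'g monoid \<Rightarrow> 'h monoid \<Rightarrow> ('g, 'h, 'x) biset \<Rightarrow> bool" where
  "left_free_biset G H X \<longleftrightarrow> finite (points X) \<and>
     (\<forall>h\<in>carrier H. \<forall>x\<in>points X. lact X h x \<in> points X) \<and>
     (\<forall>x\<in>points X. lact X \<one>\<^bsub>H\<^esub> x = x) \<and>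
     (\<forall>h\<in>carrier H. \<forall>h'\<in>carrier H. \<forall>x\<in>points X. lact X (h \<otimes>\<^bsub>H\<^esub> h') x = lact X h (lact X h' x)) \<and>
     (\<forall>x\<in>points X. \<forall>g\<in>carrier G. ract X x g \<in> points X) \<and>
     (\<forall>x\<in>points X. ract X x \<one>\<^bsub>G\<^esub> = x) \<and>
     (\<forall>x\<in>points X. \<forall>g\<in>carrier G. \<forall>g'\<in>carrier G. ract X x (g \<otimes>\<^bsub>G\<^esub> g') = ract X (ract X x g) g') \<and>
     (\<forall>h\<in>carrier H. \<forall>x\<in>points X. \<forall>g\<in>carrier G. ract X (lact X h x) g = lact X h (ract X x g)) \<and>
     (\<forall>h\<in>carrier H. \<forall>x\<in>points X. lact X h x = x \<longrightarrow> h = \<one>\<^bsub>H\<^esub>)"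

definition biset_isomorphic ::
  "'g monoid \<Rightarrow> 'h monoid \<Rightarrow> ('g, 'h, 'x) biset \<Rightarrow> ('g, 'h, 'y) biset \<Rightarrow> bool" where
  "biset_isomorphic G H X Y \<longleftrightarrow> (\<exists>f. bij_betw f (points X) (points Y) \<and>
     (\<forall>h\<in>carrier H. \<forall>x\<in>points X. f (lact X h x) = lact Y h (f x)) \<and>
     (\<forall>x\<in>points X. \<forall>g\<in>carrier G. f (ract X x g) = ract Y (f x) g))"

text \<open>
  Every finite biset is isomorphic to one whose points are natural numbers, so an isomorphism class
  is represented by the set of its members with points in \<^typ>\<open>nat\<close>.
\<close>

type_synonym ('g, 'h) biset_class = "('g, 'h, nat) biset set"

definition iso_class ::
  "'g monoid \<Rightarrow> 'h monoid \<Rightarrow> ('g, 'h, 'x) biset \<Rightarrow> ('g, 'h) biset_class" where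
  "iso_class G H X = {Y. left_free_biset G H Y \<and> biset_isomorphic G H X Y}"

definition biset_sum ::
  "('g, 'h, 'x) biset \<Rightarrow> ('g, 'h, 'y) biset \<Rightarrow> ('g, 'h, 'x + 'y) biset" where
  "biset_sum X Y = \<lparr>points = points X <+> points Y,
     lact = (\<lambda>h. map_sum (lact X h) (lact Y h)),
     ract = (\<lambda>z g. map_sum (\<lambda>x. ract X x g) (\<lambda>y. ract Y y g) z)\<rparr>"

text \<open>
  \<open>X \<times>\<^sub>H Y\<close> for an \<open>(H, K)\<close>-biset \<open>X\<close> and a \<open>(G, H)\<close>-biset \<open>Y\<close>.
\<close>

definition tensor_rel ::
  "'h monoid \<Rightarrow> ('h, 'k, 'x) biset \<Rightarrow> ('g, 'h, 'y) biset \<Rightarrow> (('x \<times> 'y) \<times> ('x \<times> 'y)) set" where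
  "tensor_rel H X Y = {((ract X x h, y), (x, lact Y h y)) | x y h.
     x \<in> points X \<and> y \<in> points Y \<and> h \<in> carrier H}"

definition biset_tensor ::
  "'h monoid \<Rightarrow> ('h, 'k, 'x) biset \<Rightarrow> ('g, 'h, 'y) biset \<Rightarrow> ('g, 'k, ('x \<times> 'y) set) biset" where
  "biset_tensor H X Y = \<lparr>points = (points X \<times> points Y) // tensor_rel H X Y,
     lact = (\<lambda>k C. (\<lambda>(x, y). (lact X k x, y)) ` C),
     ract = (\<lambda>C g. (\<lambda>(x, y). (x, ract Y y g)) ` C)\<rparr>"

text \<open>
  \<open>H \<times>\<^bsub>K,\<phi>\<^esub> G\<close> for \<open>K \<le> G\<close> and \<open>\<phi> : K \<rightarrow> H\<close>.
\<close>

definition transitive_rel ::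
  "'g monoid \<Rightarrow> 'h monoid \<Rightarrow> 'g set \<Rightarrow> ('g \<Rightarrow> 'h) \<Rightarrow> (('h \<times> 'g) \<times> ('h \<times> 'g)) set" where
  "transitive_rel G H K \<phi> = {((h, k \<otimes>\<^bsub>G\<^esub> g), (h \<otimes>\<^bsub>H\<^esub> \<phi> k, g)) | h k g.
     h \<in> carrier H \<and> k \<in> K \<and> g \<in> carrier G}"

definition transitive_biset ::
  "'g monoid \<Rightarrow> 'h monoid \<Rightarrow> 'g set \<Rightarrow> ('g \<Rightarrow> 'h) \<Rightarrow> ('g, 'h, ('h \<times> 'g) set) biset" where
  "transitive_biset G H K \<phi> = \<lparr>points = (carrier H \<times> carrier G) // transitive_rel G H K \<phi>,
     lact = (\<lambda>h' C. (\<lambda>(h, g). (h' \<otimes>\<^bsub>H\<^esub> h, g)) ` C),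
     ract = (\<lambda>C g'. (\<lambda>(h, g). (h, g \<otimes>\<^bsub>G\<^esub> g')) ` C)\<rparr>"


section \<open>\<open>p\<close>-localized Burnside modules\<close>

definition localized_ints :: "nat \<Rightarrow> rat set" where
  "localized_ints p = {of_int a / of_int b | a b. \<not> int p dvd b}"

text \<open>
  The \<open>p\<close>-localized Grothendieck group of isomorphism classes under disjoint union is the quotient
  of the free module over \<open>localized_ints p\<close> on the isomorphism classes by the submodule generated by
  the elements \<open>[X \<squnion> Y] - [X] - [Y]\<close>. Its elements are the cosets of this submodule.
\<close>

type_synonym ('g, 'h) formal_comb = "('g, 'h) biset_class \<Rightarrow>\<^sub>0 rat"

inductive_set burnside_relations ::
  "nat \<Rightarrow> 'g monoid \<Rightarrow> 'h monoid \<Rightarrow> ('g, 'h) formal_comb set"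
  for p G H where
  zero: "0 \<in> burnside_relations p G H"
| add: "r \<in> burnside_relations p G H \<Longrightarrow> c \<in> localized_ints p \<Longrightarrow>
    left_free_biset G H (X :: ('g, 'h, nat) biset) \<Longrightarrow>
    left_free_biset G H (Y :: ('g, 'h, nat) biset) \<Longrightarrow>
    r + (Poly_Mapping.single (iso_class G H (biset_sum X Y)) c
         - Poly_Mapping.single (iso_class G H X) c
         - Poly_Mapping.single (iso_class G H Y) c) \<in> burnside_relations p G H"

type_synonym ('g, 'h) burnside_elem = "('g, 'h) formal_comb set"

definition burnside_coset ::
  "nat \<Rightarrow> 'g monoid \<Rightarrow> 'h monoid \<Rightarrow> ('g, 'h) formal_comb \<Rightarrow> ('g, 'h) burnside_elem" where
  "burnside_coset p G H x = {y. y - x \<in> burnside_relations p G H}"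

definition burnside_module :: "nat \<Rightarrow> 'g monoid \<Rightarrow> 'h monoid \<Rightarrow> ('g, 'h) burnside_elem set" where
  "burnside_module p G H = {burnside_coset p G H x | x.
     (\<forall>C\<in>Poly_Mapping.keys x. \<exists>X :: ('g, 'h, nat) biset. left_free_biset G H X \<and> C = iso_class G H X) \<and>
     (\<forall>C. Poly_Mapping.lookup x C \<in> localized_ints p)}"

definition class_comp ::
  "'g monoid \<Rightarrow> 'h monoid \<Rightarrow> 'k monoid \<Rightarrow> ('h, 'k) biset_class \<Rightarrow> ('g, 'h) biset_class
     \<Rightarrow> ('g, 'k) biset_class" where
  "class_comp G H K C D = (\<Union>X\<in>C. \<Union>Y\<in>D. iso_class G K (biset_tensor H X Y))"

definition formal_comp ::
  "'g monoid \<Rightarrow> 'h monoid \<Rightarrow> 'k monoid \<Rightarrow> ('h, 'k) formal_comb \<Rightarrow> ('g, 'h) formal_comb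
     \<Rightarrow> ('g, 'k) formal_comb" where
  "formal_comp G H K x y = (\<Sum>C\<in>Poly_Mapping.keys x. \<Sum>D\<in>Poly_Mapping.keys y.
     Poly_Mapping.single (class_comp G H K C D)
       (Poly_Mapping.lookup x C * Poly_Mapping.lookup y D))"

text \<open>
  The composition pairing of the modules for \<open>(H, K)\<close> and \<open>(G, H)\<close> into the module for \<open>(G, K)\<close>,
  written \<open>A \<circ> B\<close>.
\<close>

definition burnside_comp ::
  "nat \<Rightarrow> 'g monoid \<Rightarrow> 'h monoid \<Rightarrow> 'k monoid \<Rightarrow> ('h, 'k) burnside_elem \<Rightarrow> ('g, 'h) burnside_elem
     \<Rightarrow> ('g, 'k) burnside_elem" where
  "burnside_comp p G H K A B = (\<Union>x\<in>A. \<Union>y\<in>B. burnside_coset p G K (formal_comp G H K x y))"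

text \<open>
  The class \<open>[K, \<phi>]\<close> of \<^const>\<open>transitive_biset\<close> in the module for \<open>(G, H)\<close>, and linear combinations
  of such classes; a combination is given by its finitely supported family of coefficients.
\<close>

definition basis_elem ::
  "nat \<Rightarrow> 'g monoid \<Rightarrow> 'h monoid \<Rightarrow> 'g set \<Rightarrow> ('g \<Rightarrow> 'h) \<Rightarrow> ('g, 'h) burnside_elem" where
  "basis_elem p G H K \<phi> =
     burnside_coset p G H (Poly_Mapping.single (iso_class G H (transitive_biset G H K \<phi>)) 1)"

definition basis_comb ::
  "nat \<Rightarrow> 'g monoid \<Rightarrow> 'h monoid \<Rightarrow> ('g set \<times> ('g \<Rightarrow> 'h) \<Rightarrow>\<^sub>0 rat) \<Rightarrow> ('g, 'h) burnside_elem" where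
  "basis_comb p G H c = burnside_coset p G H
     (\<Sum>(K, \<phi>)\<in>Poly_Mapping.keys c.
        Poly_Mapping.single (iso_class G H (transitive_biset G H K \<phi>)) (Poly_Mapping.lookup c (K, \<phi>)))"


section \<open>Characteristic idempotents\<close>

definition fusion_generated :: "nat \<Rightarrow> 'a monoid \<Rightarrow> 'a hom_sets \<Rightarrow> ('a, 'a) burnside_elem \<Rightarrow> bool" where
  "fusion_generated p S F X \<longleftrightarrow> (\<exists>c.
     (\<forall>(P, \<phi>)\<in>Poly_Mapping.keys c. subgroup P S \<and> \<phi> \<in> F P (carrier S)) \<and>
     (\<forall>i. Poly_Mapping.lookup c i \<in> localized_ints p) \<and>
     X = basis_comb p S S c)"

definition right_stable ::
  "nat \<Rightarrow> 'a monoid \<Rightarrow> 'a hom_sets \<Rightarrow> 'h monoid \<Rightarrow> ('a, 'h) burnside_elem \<Rightarrow> bool" where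
  "right_stable p S F H X \<longleftrightarrow> (\<forall>P \<phi>. subgroup P S \<longrightarrow> \<phi> \<in> F P (carrier S) \<longrightarrow>
     burnside_comp p (S\<lparr>carrier := P\<rparr>) S H X (basis_elem p (S\<lparr>carrier := P\<rparr>) S P \<phi>) =
     burnside_comp p (S\<lparr>carrier := P\<rparr>) S H X (basis_elem p (S\<lparr>carrier := P\<rparr>) S P (\<lambda>x\<in>P. x)))"

definition left_stable ::
  "nat \<Rightarrow> 'a monoid \<Rightarrow> 'a hom_sets \<Rightarrow> 'h monoid \<Rightarrow> ('h, 'a) burnside_elem \<Rightarrow> bool" where
  "left_stable p S F H X \<longleftrightarrow> (\<forall>P \<phi>. subgroup P S \<longrightarrow> \<phi> \<in> F P (carrier S) \<longrightarrow>
     burnside_comp p H S (S\<lparr>carrier := P\<rparr>)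
       (basis_elem p S (S\<lparr>carrier := P\<rparr>) (\<phi> ` P) (\<lambda>y\<in>\<phi> ` P. inv_into P \<phi> y)) X =
     burnside_comp p H S (S\<lparr>carrier := P\<rparr>)
       (basis_elem p S (S\<lparr>carrier := P\<rparr>) P (\<lambda>x\<in>P. x)) X)"

text \<open>
  The linear extension of \<open>[P, \<phi>] \<mapsto> |S/P|\<close>: the value at any linear combination of the classes
  \<open>[P, \<phi>]\<close> that represents \<open>X\<close>.
\<close>

definition augmentation :: "nat \<Rightarrow> 'a monoid \<Rightarrow> ('a, 'a) burnside_elem \<Rightarrow> rat" where
  "augmentation p S X = (THE r. \<exists>c.
     (\<forall>(P, \<phi>)\<in>Poly_Mapping.keys c. subgroup P S \<and> \<phi> \<in> hom (S\<lparr>carrier := P\<rparr>) S) \<and>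
     (\<forall>i. Poly_Mapping.lookup c i \<in> localized_ints p) \<and>
     X = basis_comb p S S c \<and>
     r = (\<Sum>(P, \<phi>)\<in>Poly_Mapping.keys c.
            Poly_Mapping.lookup c (P, \<phi>) * of_nat (card (rcosets\<^bsub>S\<^esub> P))))"

definition characteristic_idempotent ::
  "nat \<Rightarrow> 'a monoid \<Rightarrow> 'a hom_sets \<Rightarrow> ('a, 'a) burnside_elem \<Rightarrow> bool" where
  "characteristic_idempotent p S F \<omega> \<longleftrightarrow>
     \<omega> \<in> burnside_module p S S \<and>
     burnside_comp p S S S \<omega> \<omega> = \<omega> \<and>
     fusion_generated p S F \<omega> \<and>
     right_stable p S F S \<omega> \<and>
     left_stable p S F S \<omega> \<and>
     \<not> (\<exists>s\<in>localized_ints p. augmentation p S \<omega> = of_nat p * s)"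

end

theory Submission
  imports Defs
begin

text \<open>
  For maps \<open>\<alpha> : Q \<rightarrow> H\<close> and \<open>\<beta> : Q \<rightarrow> G\<close> and a \<open>(G, H)\<close>-biset \<open>X\<close> let \<open>\<Phi>\<^bsub>\<alpha>,\<beta>\<^esub>(X)\<close> be the number of
  \<open>x\<close> with \<open>\<alpha>(q) x = x \<beta>(q)\<close> for all \<open>q\<close>. This mark is additive, and it turns composition into a matrix
  product: \<open>|H| \<Phi>\<^bsub>\<alpha>,\<beta>\<^esub>(X \<times>\<^sub>H Y)\<close> is the sum of \<open>\<Phi>\<^bsub>\<alpha>,\<gamma>\<^esub>(X) \<Phi>\<^bsub>\<gamma>,\<beta>\<^esub>(Y)\<close> over all \<open>\<gamma> : Q \<rightarrow> H\<close>.

  Let \<open>\<phi> : P \<rightarrow> Q\<close> be a morphism of \<open>F\<close> with \<open>P \<le> T\<close>. If \<open>\<Phi>\<^bsub>\<phi>,incl\<^esub>\<close> does not vanish on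
  \<open>\<omega>\<^sub>H \<circ> [T, incl] \<circ> \<omega>\<^sub>K\<close>, then there is \<open>\<gamma> : P \<rightarrow> T\<close> such that \<open>\<Phi>\<^bsub>\<phi>,\<gamma>\<^esub>(\<omega>\<^sub>H)\<close> and
  \<open>\<Phi>\<^bsub>\<gamma>,incl\<^esub>(\<omega>\<^sub>K)\<close> are nonzero. As \<open>\<omega>\<^sub>K\<close> is \<open>K\<close>-generated and \<open>\<omega>\<^sub>H\<close> is \<open>H\<close>-generated, \<open>\<gamma>\<close> is a
  morphism of \<open>K\<close> and \<open>\<phi> = \<eta> \<circ> \<gamma>\<close> with \<open>\<eta>\<close> in \<open>H\<close>.

  On \<open>\<omega>\<^sub>F \<circ> [T, incl]\<close> the mark equals \<open>\<Phi>\<^bsub>\<phi>,incl\<^esub>(\<omega>\<^sub>F)\<close>, which by right stability is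
  \<open>\<Phi>\<^bsub>incl,incl\<^esub>(\<omega>\<^sub>F)\<close> for the subgroup \<open>R = \<phi>(P)\<close>. Again by stability, the sum of
  \<open>\<Phi>\<^bsub>incl,\<chi>\<^esub>(\<omega>\<^sub>F)\<close> over \<open>\<chi> \<in> Hom\<^sub>F(R, S)\<close> is a multiple of this number. The contribution of \<open>[D, \<psi>]\<close>
  to the sum is \<open>|S|\<close> times the number of cosets of \<open>\<psi>(D)\<close> fixed by \<open>R\<close>, which is congruent to
  \<open>|S/D|\<close> modulo \<open>p\<close>. So the sum divided by \<open>|S|\<close> is congruent to the augmentation of \<open>\<omega>\<^sub>F\<close>, hence
  nonzero.
\<close>

section \<open>Double counting of intertwining elements\<close>

lemma sum_card_eq_card:
  assumes "finite I" "finite A" "\<And>a. a \<in> A \<Longrightarrow> \<exists>!i. i \<in> I \<and> R i a"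
  shows "(\<Sum>i\<in>I. card {a \<in> A. R i a}) = card A"
proof -
  have "card {i \<in> I. R i a} = 1" if a: "a \<in> A" for a
  proof -
    obtain i where "i \<in> I \<and> R i a" "\<And>j. j \<in> I \<and> R j a \<Longrightarrow> j = i" using assms(3)[OF a] by blast
    then have "{i \<in> I. R i a} = {i}" by blast
    then show ?thesis by simp
  qed
  then show ?thesis using sum_multicount_gen[OF assms(1,2), of R "\<lambda>_. 1"] by simp
qed

text \<open>An element \<open>g\<close> intertwines \<beta> with exactly one map, the conjugate
  \<open>q \<mapsto> g \<otimes> \<beta> q \<otimes> inv g\<close>, so every \<open>g\<close> is
  counted once. Later this sum cancels the group order that the tensor formula introduces.\<close>

lemma (in group) sum_card_intertwiners:
  assumes "finite Q" "finite (carrier G)" "\<beta> \<in> Q \<rightarrow> carrier G"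
  shows "(\<Sum>\<gamma>\<in>Q \<rightarrow>\<^sub>E carrier G. card {g \<in> carrier G. \<forall>q\<in>Q. \<gamma> q \<otimes> g = g \<otimes> \<beta> q}) = card (carrier G)"
proof (rule sum_card_eq_card)
  show "finite (Q \<rightarrow>\<^sub>E carrier G)" using assms by (intro finite_PiE) auto
  fix g assume g: "g \<in> carrier G"
  show "\<exists>!\<gamma>. \<gamma> \<in> Q \<rightarrow>\<^sub>E carrier G \<and> (\<forall>q\<in>Q. \<gamma> q \<otimes> g = g \<otimes> \<beta> q)"
  proof (rule ex1I)
    show "(\<lambda>q\<in>Q. g \<otimes> \<beta> q \<otimes> inv g) \<in> Q \<rightarrow>\<^sub>E carrier G \<and>
        (\<forall>q\<in>Q. (\<lambda>q\<in>Q. g \<otimes> \<beta> q \<otimes> inv g) q \<otimes> g = g \<otimes> \<beta> q)"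
      using g assms(3) by (auto simp: m_assoc Pi_iff)
    fix \<gamma> assume \<gamma>: "\<gamma> \<in> Q \<rightarrow>\<^sub>E carrier G \<and> (\<forall>q\<in>Q. \<gamma> q \<otimes> g = g \<otimes> \<beta> q)"
    show "\<gamma> = (\<lambda>q\<in>Q. g \<otimes> \<beta> q \<otimes> inv g)"
    proof (rule extensionalityI[of _ Q])
      fix q assume q: "q \<in> Q"
      then have "\<gamma> q \<in> carrier G" "\<beta> q \<in> carrier G" "\<gamma> q \<otimes> g = g \<otimes> \<beta> q" using \<gamma> assms(3) by auto
      then show "\<gamma> q = (\<lambda>q\<in>Q. g \<otimes> \<beta> q \<otimes> inv g) q"
        using g q by (simp, metis inv_solve_right m_closed)
    qed (use \<gamma> in \<open>auto simp: PiE_def\<close>)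
  qed
qed (rule assms)

subsection \<open>Fixed points of bisets\<close>

text \<open>\<open>Q\<close> is a bare index set and the two maps need not be homomorphisms. So the
  intermediate maps of a composition can range over all of
  \<open>Q \<rightarrow>\<^sub>E carrier H\<close>, and \<open>Q = {}\<close> counts all
  points.\<close>

definition biset_fix ::
  "'i set \<Rightarrow> ('i \<Rightarrow> 'h) \<Rightarrow> ('i \<Rightarrow> 'g) \<Rightarrow> ('g, 'h, 'x) biset \<Rightarrow> 'x set" where
  "biset_fix Q \<alpha> \<beta> X = {x \<in> points X. \<forall>q\<in>Q. lact X (\<alpha> q) x = ract X x (\<beta> q)}"

lemma left_free_bisetD:
  assumes "left_free_biset G H X"
  shows "finite (points X)"
    and "\<And>h x. h \<in> carrier H \<Longrightarrow> x \<in> points X \<Longrightarrow> lact X h x \<in> points X"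
    and "\<And>x. x \<in> points X \<Longrightarrow> lact X \<one>\<^bsub>H\<^esub> x = x"
    and "\<And>h h' x. h \<in> carrier H \<Longrightarrow> h' \<in> carrier H \<Longrightarrow> x \<in> points X \<Longrightarrow>
      lact X (h \<otimes>\<^bsub>H\<^esub> h') x = lact X h (lact X h' x)"
    and "\<And>x g. x \<in> points X \<Longrightarrow> g \<in> carrier G \<Longrightarrow> ract X x g \<in> points X"
    and "\<And>x. x \<in> points X \<Longrightarrow> ract X x \<one>\<^bsub>G\<^esub> = x"
    and "\<And>x g g'. x \<in> points X \<Longrightarrow> g \<in> carrier G \<Longrightarrow> g' \<in> carrier G \<Longrightarrow>
      ract X x (g \<otimes>\<^bsub>G\<^esub> g') = ract X (ract X x g) g'"
    and "\<And>h x g. h \<in> carrier H \<Longrightarrow> x \<in> points X \<Longrightarrow> g \<in> carrier G \<Longrightarrow>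
      ract X (lact X h x) g = lact X h (ract X x g)"
    and "\<And>h x. h \<in> carrier H \<Longrightarrow> x \<in> points X \<Longrightarrow> lact X h x = x \<Longrightarrow> h = \<one>\<^bsub>H\<^esub>"
  using assms unfolding left_free_biset_def by blast+

lemma lact_left_cancel:
  assumes "group H" "left_free_biset G H X" "h \<in> carrier H" "h' \<in> carrier H" "x \<in> points X"
    and "lact X h x = lact X h' x"
  shows "h = h'"
proof -
  interpret H: group H by fact
  note X = left_free_bisetD[OF assms(2)]
  have "lact X (inv\<^bsub>H\<^esub> h' \<otimes>\<^bsub>H\<^esub> h) x = x"
    using assms X(3,4) by (metis H.inv_closed H.l_inv)
  then have "inv\<^bsub>H\<^esub> h' \<otimes>\<^bsub>H\<^esub> h = \<one>\<^bsub>H\<^esub>"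
    using X(9) assms by simp
  then show ?thesis
    using assms by (metis H.inv_closed H.inv_equality H.inv_inv)
qed

lemma finite_biset_fix: "finite (points X) \<Longrightarrow> finite (biset_fix Q \<alpha> \<beta> X)"
  by (simp add: biset_fix_def)

lemma biset_fix_cong:
  assumes "\<And>q. q \<in> Q \<Longrightarrow> \<alpha> q = \<alpha>' q" "\<And>q. q \<in> Q \<Longrightarrow> \<beta> q = \<beta>' q"
  shows "biset_fix Q \<alpha> \<beta> X = biset_fix Q \<alpha>' \<beta>' X"
  using assms by (auto simp: biset_fix_def)

lemma biset_isomorphic_refl: "biset_isomorphic G H X X"
  unfolding biset_isomorphic_def by (rule exI[of _ "\<lambda>x. x"]) (auto simp: bij_betw_def)

lemma biset_isomorphic_sym:
  assumes "left_free_biset G H X" "biset_isomorphic G H X Y"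
  shows "biset_isomorphic G H Y X"
proof -
  note X = left_free_bisetD[OF assms(1)]
  obtain f where f: "bij_betw f (points X) (points Y)"
    "\<And>h x. h \<in> carrier H \<Longrightarrow> x \<in> points X \<Longrightarrow> f (lact X h x) = lact Y h (f x)"
    "\<And>x g. x \<in> points X \<Longrightarrow> g \<in> carrier G \<Longrightarrow> f (ract X x g) = ract Y (f x) g"
    using assms(2) unfolding biset_isomorphic_def by blast
  let ?f = "inv_into (points X) f"
  have inv: "?f y \<in> points X" "f (?f y) = y" if "y \<in> points Y" for y
    using that f(1) by (auto simp: bij_betw_def intro: inv_into_into f_inv_into_f)
  have eq: "?f y = x" if "x \<in> points X" "f x = y" for x y
    using that f(1) by (metis bij_betw_inv_into_left)
  show ?thesis
    unfolding biset_isomorphic_def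
  proof (intro exI[of _ ?f] conjI ballI)
    show "bij_betw ?f (points Y) (points X)" using f(1) by (rule bij_betw_inv_into)
  next
    fix h y assume "h \<in> carrier H" "y \<in> points Y"
    then show "?f (lact Y h y) = lact X h (?f y)"
      by (intro eq) (simp_all add: inv f X)
  next
    fix g y assume "g \<in> carrier G" "y \<in> points Y"
    then show "?f (ract Y y g) = ract X (?f y) g"
      by (intro eq) (simp_all add: inv f X)
  qed
qed

lemma biset_isomorphic_trans:
  assumes "biset_isomorphic G H X Y" "biset_isomorphic G H Y Z"
  shows "biset_isomorphic G H X Z"
proof -
  obtain f where f: "bij_betw f (points X) (points Y)"
    "\<And>h x. h \<in> carrier H \<Longrightarrow> x \<in> points X \<Longrightarrow> f (lact X h x) = lact Y h (f x)"
    "\<And>x g. x \<in> points X \<Longrightarrow> g \<in> carrier G \<Longrightarrow> f (ract X x g) = ract Y (f x) g"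
    using assms(1) unfolding biset_isomorphic_def by blast
  obtain f' where f': "bij_betw f' (points Y) (points Z)"
    "\<And>h x. h \<in> carrier H \<Longrightarrow> x \<in> points Y \<Longrightarrow> f' (lact Y h x) = lact Z h (f' x)"
    "\<And>x g. x \<in> points Y \<Longrightarrow> g \<in> carrier G \<Longrightarrow> f' (ract Y x g) = ract Z (f' x) g"
    using assms(2) unfolding biset_isomorphic_def by blast
  have "f x \<in> points Y" if "x \<in> points X" for x
    using that f(1) by (rule bij_betwE[rule_format, rotated])
  then show ?thesis
    unfolding biset_isomorphic_def
    by (intro exI[of _ "f' \<circ> f"]) (simp add: f f' bij_betw_trans[OF f(1) f'(1)])
qed

lemma card_biset_fix_isomorphic:
  assumes "biset_isomorphic G H X Y" "\<alpha> \<in> Q \<rightarrow> carrier H" "\<beta> \<in> Q \<rightarrow> carrier G"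
    and "left_free_biset G H X"
  shows "card (biset_fix Q \<alpha> \<beta> X) = card (biset_fix Q \<alpha> \<beta> Y)"
proof -
  note X = left_free_bisetD[OF assms(4)]
  obtain f where f: "bij_betw f (points X) (points Y)"
    "\<And>h x. h \<in> carrier H \<Longrightarrow> x \<in> points X \<Longrightarrow> f (lact X h x) = lact Y h (f x)"
    "\<And>x g. x \<in> points X \<Longrightarrow> g \<in> carrier G \<Longrightarrow> f (ract X x g) = ract Y (f x) g"
    using assms(1) unfolding biset_isomorphic_def by blast
  have inj: "inj_on f (points X)" and im: "f ` points X = points Y"
    using f(1) by (auto simp: bij_betw_def)
  have iff: "f x \<in> biset_fix Q \<alpha> \<beta> Y \<longleftrightarrow> x \<in> biset_fix Q \<alpha> \<beta> X" if x: "x \<in> points X" for x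
  proof -
    have "lact Y (\<alpha> q) (f x) = ract Y (f x) (\<beta> q) \<longleftrightarrow> lact X (\<alpha> q) x = ract X x (\<beta> q)"
      if "q \<in> Q" for q
    proof -
      have "\<alpha> q \<in> carrier H" "\<beta> q \<in> carrier G" using assms that by auto
      then show ?thesis
        using f(2,3) x X(2,5) inj by (metis inj_onD)
    qed
    then show ?thesis using x im by (auto simp: biset_fix_def)
  qed
  have "f ` biset_fix Q \<alpha> \<beta> X = biset_fix Q \<alpha> \<beta> Y"
  proof
    show "f ` biset_fix Q \<alpha> \<beta> X \<subseteq> biset_fix Q \<alpha> \<beta> Y"
      using iff by (auto simp: biset_fix_def)
    show "biset_fix Q \<alpha> \<beta> Y \<subseteq> f ` biset_fix Q \<alpha> \<beta> X"
    proof
      fix y assume y: "y \<in> biset_fix Q \<alpha> \<beta> Y"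
      then have "y \<in> f ` points X" using im by (simp add: biset_fix_def)
      then show "y \<in> f ` biset_fix Q \<alpha> \<beta> X" using iff y by auto
    qed
  qed
  moreover have "inj_on f (biset_fix Q \<alpha> \<beta> X)"
    using inj by (rule inj_on_subset) (auto simp: biset_fix_def)
  ultimately show ?thesis by (metis card_image)
qed

lemma left_free_biset_sum:
  "left_free_biset G H X \<Longrightarrow> left_free_biset G H Y \<Longrightarrow> left_free_biset G H (biset_sum X Y)"
  unfolding left_free_biset_def biset_sum_def by auto

lemma card_biset_fix_sum:
  assumes "finite (points X)" "finite (points Y)"
  shows "card (biset_fix Q \<alpha> \<beta> (biset_sum X Y)) =
    card (biset_fix Q \<alpha> \<beta> X) + card (biset_fix Q \<alpha> \<beta> Y)"
proof -
  have "biset_fix Q \<alpha> \<beta> (biset_sum X Y) = biset_fix Q \<alpha> \<beta> X <+> biset_fix Q \<alpha> \<beta> Y"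
    unfolding biset_fix_def biset_sum_def by auto
  then show ?thesis using assms by (simp add: card_Plus finite_biset_fix)
qed

text \<open>Transporting the actions along an injection into the naturals shows that
  \<open>iso_class\<close> is never empty for a left free biset, so a representative can be chosen
  from it.\<close>

lemma exists_nat_biset:
  assumes "left_free_biset G H X"
  shows "\<exists>Y :: ('g, 'h, nat) biset. left_free_biset G H Y \<and> biset_isomorphic G H (X :: ('g, 'h, 'x) biset) Y"
proof -
  note X = left_free_bisetD[OF assms]
  obtain f :: "'x \<Rightarrow> nat" where inj: "inj_on f (points X)"
    using X(1) finite_imp_inj_to_nat_seg by blast
  let ?i = "inv_into (points X) f"
  define Y where "Y = \<lparr>points = f ` points X, lact = (\<lambda>h y. f (lact X h (?i y))),
    ract = (\<lambda>y g. f (ract X (?i y) g))\<rparr>"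
  have i: "?i (f x) = x" if "x \<in> points X" for x using inj that by simp
  have "left_free_biset G H Y"
    unfolding left_free_biset_def Y_def
    by (auto simp: i X dest: inj_onD[OF inj])
  moreover have "biset_isomorphic G H X Y"
    unfolding biset_isomorphic_def Y_def
    by (rule exI[of _ f]) (auto simp: i inj bij_betw_def)
  ultimately show ?thesis by blast
qed

lemma iso_class_eqI:
  assumes "left_free_biset G H X" "biset_isomorphic G H X Y"
  shows "iso_class G H X = iso_class G H Y"
  unfolding iso_class_def
  using biset_isomorphic_trans[OF assms(2)] biset_isomorphic_trans[OF biset_isomorphic_sym[OF assms]]
  by blast

subsection \<open>Tensor products\<close>

text \<open>The orbit of \<open>(x, y)\<close> when \<open>h\<close> acts by
  \<open>(ract X x (inv h), lact Y h y)\<close>. Parametrizing the points of the tensor product by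
  \<open>H\<close> in this way gives access to their number of elements.\<close>

definition tensor_point :: "'h monoid \<Rightarrow> ('h, 'k, 'x) biset \<Rightarrow> ('g, 'h, 'y) biset \<Rightarrow> 'x \<Rightarrow> 'y
    \<Rightarrow> ('x \<times> 'y) set" where
  "tensor_point H X Y x y = (\<lambda>h. (ract X x (inv\<^bsub>H\<^esub> h), lact Y h y)) ` carrier H"

locale tensor_bisets =
  fixes G :: "'g monoid" and H :: "'h monoid" and K :: "'k monoid"
    and X :: "('h, 'k, 'x) biset" and Y :: "('g, 'h, 'y) biset"
  assumes grpG: "group G" and grp: "group H" and grpK: "group K"
    and X: "left_free_biset H K X" and Y: "left_free_biset G H Y"
begin

sublocale G: group G by (rule grpG)
sublocale H: group H by (rule grp)
sublocale K: group K by (rule grpK)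

lemmas XD = left_free_bisetD[OF X]
lemmas YD = left_free_bisetD[OF Y]

text \<open>Moving one factor across the product already reaches every point of the orbit, because
  \<open>H\<close> is a group. So the quotient by \<open>tensor_rel\<close> consists of orbits,
  without passing to a generated equivalence relation.\<close>

lemma tensor_rel_iff:
  assumes "x \<in> points X" "y \<in> points Y"
  shows "((x, y), (x', y')) \<in> tensor_rel H X Y \<longleftrightarrow>
    (\<exists>h\<in>carrier H. x' = ract X x (inv\<^bsub>H\<^esub> h) \<and> y' = lact Y h y)"
proof
  assume "((x, y), (x', y')) \<in> tensor_rel H X Y"
  then obtain h where h: "h \<in> carrier H" "x' \<in> points X" "x = ract X x' h" "y' = lact Y h y"
    unfolding tensor_rel_def by auto
  then have "ract X x (inv\<^bsub>H\<^esub> h) = x'"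
    using XD(6,7) by (metis H.inv_closed H.r_inv)
  then show "\<exists>h\<in>carrier H. x' = ract X x (inv\<^bsub>H\<^esub> h) \<and> y' = lact Y h y"
    using h by (intro bexI[of _ h]) simp_all
next
  assume "\<exists>h\<in>carrier H. x' = ract X x (inv\<^bsub>H\<^esub> h) \<and> y' = lact Y h y"
  then obtain h where h: "h \<in> carrier H" "x' = ract X x (inv\<^bsub>H\<^esub> h)" "y' = lact Y h y" by auto
  then have "x' \<in> points X" "x = ract X x' h"
    using XD assms by (simp, metis H.inv_closed H.l_inv)
  then show "((x, y), (x', y')) \<in> tensor_rel H X Y"
    unfolding tensor_rel_def using h assms by blast
qed

lemma tensor_rel_Image:
  assumes "x \<in> points X" "y \<in> points Y"
  shows "tensor_rel H X Y `` {(x, y)} = tensor_point H X Y x y"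
  using tensor_rel_iff[OF assms] by (auto simp: tensor_point_def)

lemma points_tensor: "points (biset_tensor H X Y) =
    {tensor_point H X Y x y | x y. x \<in> points X \<and> y \<in> points Y}"
  unfolding biset_tensor_def quotient_def by (auto simp: tensor_rel_Image) blast+

lemma tensor_point_self:
  assumes "x \<in> points X" "y \<in> points Y"
  shows "(x, y) \<in> tensor_point H X Y x y"
  unfolding tensor_point_def using assms XD YD
  by (intro image_eqI[of _ _ "\<one>\<^bsub>H\<^esub>"]) auto

text \<open>Right translation of the parameter identifies the two orbits: \<open>k\<close> on the
  left corresponds to \<open>k \<otimes> inv h\<close> on the right, and conversely \<open>k\<close>
  on the right to \<open>k \<otimes> h\<close> on the left.\<close>

lemma tensor_point_shift:
  assumes "x \<in> points X" "y \<in> points Y" "h \<in> carrier H"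
  shows "tensor_point H X Y (ract X x h) y = tensor_point H X Y x (lact Y h y)"
proof -
  have 1: "tensor_point H X Y (ract X x h) y \<subseteq> tensor_point H X Y x (lact Y h y)"
    if "x \<in> points X" "y \<in> points Y" "h \<in> carrier H" for x y h
  proof
    fix z assume "z \<in> tensor_point H X Y (ract X x h) y"
    then obtain k where k: "k \<in> carrier H" "z = (ract X (ract X x h) (inv\<^bsub>H\<^esub> k), lact Y k y)"
      by (auto simp: tensor_point_def)
    have "ract X (ract X x h) (inv\<^bsub>H\<^esub> k) = ract X x (inv\<^bsub>H\<^esub> (k \<otimes>\<^bsub>H\<^esub> inv\<^bsub>H\<^esub> h))"
      using that k XD by (simp add: H.inv_mult_group)
    moreover have "lact Y k y = lact Y (k \<otimes>\<^bsub>H\<^esub> inv\<^bsub>H\<^esub> h) (lact Y h y)"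
      using that k by (simp add: YD(2) YD(4)[symmetric] H.m_assoc)
    ultimately show "z \<in> tensor_point H X Y x (lact Y h y)"
      unfolding tensor_point_def k(2) using that k
      by (intro image_eqI[of _ _ "k \<otimes>\<^bsub>H\<^esub> inv\<^bsub>H\<^esub> h"]) simp_all
  qed
  have 2: "tensor_point H X Y x (lact Y h y) \<subseteq> tensor_point H X Y (ract X x h) y"
  proof
    fix z assume "z \<in> tensor_point H X Y x (lact Y h y)"
    then obtain k where k: "k \<in> carrier H" "z = (ract X x (inv\<^bsub>H\<^esub> k), lact Y k (lact Y h y))"
      by (auto simp: tensor_point_def)
    have "ract X (ract X x h) (inv\<^bsub>H\<^esub> (k \<otimes>\<^bsub>H\<^esub> h)) = ract X x (inv\<^bsub>H\<^esub> k)"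
      using assms k by (simp add: XD(5) XD(7)[symmetric] H.inv_mult_group H.m_assoc[symmetric])
    then show "z \<in> tensor_point H X Y (ract X x h) y"
      unfolding tensor_point_def k(2) using assms k YD
      by (intro image_eqI[of _ _ "k \<otimes>\<^bsub>H\<^esub> h"]) simp_all
  qed
  from 1[OF assms] 2 show ?thesis by blast
qed

lemma tensor_point_eq_iff:
  assumes "x \<in> points X" "y \<in> points Y" "x' \<in> points X" "y' \<in> points Y"
  shows "tensor_point H X Y x y = tensor_point H X Y x' y' \<longleftrightarrow>
    (\<exists>h\<in>carrier H. x = ract X x' h \<and> lact Y h y = y')"
proof
  assume "tensor_point H X Y x y = tensor_point H X Y x' y'"
  then have "(x', y') \<in> tensor_point H X Y x y" using tensor_point_self assms by simp
  then obtain h where "h \<in> carrier H" "x' = ract X x (inv\<^bsub>H\<^esub> h)" "y' = lact Y h y"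
    by (auto simp: tensor_point_def)
  then show "\<exists>h\<in>carrier H. x = ract X x' h \<and> lact Y h y = y'"
    using assms XD by (intro bexI[of _ h]) (simp_all add: XD(7)[symmetric])
qed (use assms tensor_point_shift in auto)

lemma mem_tensor_pointD:
  assumes "z \<in> points (biset_tensor H X Y)" "(x, y) \<in> z"
  shows "x \<in> points X" "y \<in> points Y" "z = tensor_point H X Y x y"
proof -
  from assms(1) obtain x0 y0 where
    xy: "x0 \<in> points X" "y0 \<in> points Y" "z = tensor_point H X Y x0 y0"
    unfolding points_tensor by auto
  obtain h where h: "h \<in> carrier H" "x = ract X x0 (inv\<^bsub>H\<^esub> h)" "y = lact Y h y0"
    using assms(2) unfolding xy(3) tensor_point_def by auto
  show p: "x \<in> points X" "y \<in> points Y" using h xy XD YD by auto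
  have "x0 = ract X x h" using h xy by (simp add: XD(6) XD(7)[symmetric])
  then show "z = tensor_point H X Y x y" using xy p h tensor_point_eq_iff by blast
qed

lemma lact_tensor:
  assumes "k \<in> carrier K" "x \<in> points X"
  shows "lact (biset_tensor H X Y) k (tensor_point H X Y x y) = tensor_point H X Y (lact X k x) y"
  unfolding biset_tensor_def tensor_point_def
  using assms XD by (auto simp: image_image)

lemma ract_tensor:
  assumes "g \<in> carrier G" "y \<in> points Y"
  shows "ract (biset_tensor H X Y) (tensor_point H X Y x y) g = tensor_point H X Y x (ract Y y g)"
  unfolding biset_tensor_def tensor_point_def
  using assms YD by (auto simp: image_image)

text \<open>If \<open>k\<close> fixes the class of \<open>(x, y)\<close>, then
  \<open>k x = x h\<close> and \<open>h y = y\<close> for some \<open>h\<close>. Freeness on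
  \<open>Y\<close> gives \<open>h = 1\<close>, and then freeness on \<open>X\<close> gives
  \<open>k = 1\<close>.\<close>

lemma left_free_tensor: "left_free_biset G K (biset_tensor H X Y)"
proof -
  have "points (biset_tensor H X Y) = (\<lambda>(x, y). tensor_point H X Y x y) ` (points X \<times> points Y)"
    unfolding points_tensor by auto
  then have fin: "finite (points (biset_tensor H X Y))" using XD(1) YD(1) by simp
  have free: "k = \<one>\<^bsub>K\<^esub>" if kxy: "k \<in> carrier K" "x \<in> points X" "y \<in> points Y"
    "tensor_point H X Y (lact X k x) y = tensor_point H X Y x y" for k x y
  proof -
    obtain h where h: "h \<in> carrier H" "lact X k x = ract X x h" "lact Y h y = y"
      using kxy tensor_point_eq_iff[of "lact X k x" y x y] XD(2) by auto
    then have "h = \<one>\<^bsub>H\<^esub>" using YD(9) kxy by blast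
    then show ?thesis using h kxy XD(6,9) by metis
  qed
  have pts: "tensor_point H X Y x y \<in> points (biset_tensor H X Y)"
    if "x \<in> points X" "y \<in> points Y" for x y
    unfolding points_tensor using that by auto
  have elim: "\<exists>x y. z = tensor_point H X Y x y \<and> x \<in> points X \<and> y \<in> points Y"
    if "z \<in> points (biset_tensor H X Y)" for z
    using that unfolding points_tensor by auto
  show ?thesis
    unfolding left_free_biset_def
    by (intro conjI ballI impI; (rule fin)?;
        (drule elim, elim exE conjE; simp add: lact_tensor ract_tensor pts XD YD free)?)
qed

text \<open>The class is fixed iff for each \<open>q\<close> the pairs
  \<open>(\<alpha> q x, y)\<close> and \<open>(x, y \<beta> q)\<close> lie in the same class, that
  is, iff an element of \<open>H\<close> links them. These elements are the values of
  \<gamma>.\<close>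

lemma tensor_point_fixed_iff:
  assumes "x \<in> points X" "y \<in> points Y" "\<alpha> \<in> Q \<rightarrow> carrier K" "\<beta> \<in> Q \<rightarrow> carrier G"
  shows "tensor_point H X Y x y \<in> biset_fix Q \<alpha> \<beta> (biset_tensor H X Y) \<longleftrightarrow>
    (\<exists>\<gamma>\<in>Q \<rightarrow>\<^sub>E carrier H. x \<in> biset_fix Q \<alpha> \<gamma> X \<and> y \<in> biset_fix Q \<gamma> \<beta> Y)"
proof -
  have "lact (biset_tensor H X Y) (\<alpha> q) (tensor_point H X Y x y) =
      ract (biset_tensor H X Y) (tensor_point H X Y x y) (\<beta> q) \<longleftrightarrow>
      (\<exists>h\<in>carrier H. lact X (\<alpha> q) x = ract X x h \<and> lact Y h y = ract Y y (\<beta> q))"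
    if "q \<in> Q" for q
  proof -
    have ab: "\<alpha> q \<in> carrier K" "\<beta> q \<in> carrier G" using assms that by auto
    then show ?thesis
      by (simp add: lact_tensor ract_tensor assms tensor_point_eq_iff XD YD)
  qed
  then have "tensor_point H X Y x y \<in> biset_fix Q \<alpha> \<beta> (biset_tensor H X Y) \<longleftrightarrow>
      (\<forall>q\<in>Q. \<exists>h\<in>carrier H. lact X (\<alpha> q) x = ract X x h \<and> lact Y h y = ract Y y (\<beta> q))"
    unfolding biset_fix_def points_tensor using assms by auto
  also have "\<dots> \<longleftrightarrow> (\<exists>\<gamma>\<in>Q \<rightarrow>\<^sub>E carrier H. \<forall>q\<in>Q.
      lact X (\<alpha> q) x = ract X x (\<gamma> q) \<and> lact Y (\<gamma> q) y = ract Y y (\<beta> q))" (is "?L \<longleftrightarrow> ?R")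
  proof
    assume ?L
    \<comment> \<open>The value of \<gamma> is chosen separately for each \<open>q\<close>, without
      any compatibility; restriction to \<open>Q\<close> then makes the map extensional.\<close>
    then obtain \<gamma> where "\<forall>q\<in>Q. \<gamma> q \<in> carrier H \<and> lact X (\<alpha> q) x = ract X x (\<gamma> q) \<and>
      lact Y (\<gamma> q) y = ract Y y (\<beta> q)" by metis
    then show ?R by (intro bexI[of _ "restrict \<gamma> Q"]) auto
  qed blast
  finally show ?thesis using assms by (auto simp: biset_fix_def)
qed

text \<open>Since \<open>H\<close> acts freely on \<open>Y\<close>, a fixed class of \<open>(x, y)\<close> determines \<open>\<gamma>\<close>.\<close>

lemma card_biset_fix_tensor:
  assumes "finite Q" "finite (carrier H)" "\<alpha> \<in> Q \<rightarrow> carrier K" "\<beta> \<in> Q \<rightarrow> carrier G"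
  shows "card (carrier H) * card (biset_fix Q \<alpha> \<beta> (biset_tensor H X Y)) =
    (\<Sum>\<gamma>\<in>Q \<rightarrow>\<^sub>E carrier H. card (biset_fix Q \<alpha> \<gamma> X) * card (biset_fix Q \<gamma> \<beta> Y))"
proof -
  let ?fix = "biset_fix Q \<alpha> \<beta> (biset_tensor H X Y)"
  let ?D = "\<lambda>\<gamma>. biset_fix Q \<alpha> \<gamma> X \<times> biset_fix Q \<gamma> \<beta> Y"
  have finH: "finite (Q \<rightarrow>\<^sub>E carrier H)" using assms by (intro finite_PiE) auto
  have disj: "?D \<gamma> \<inter> ?D \<gamma>' = {}"
    if g: "\<gamma> \<in> Q \<rightarrow>\<^sub>E carrier H" "\<gamma>' \<in> Q \<rightarrow>\<^sub>E carrier H" "\<gamma> \<noteq> \<gamma>'" for \<gamma> \<gamma>'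
  proof (rule ccontr)
    assume "?D \<gamma> \<inter> ?D \<gamma>' \<noteq> {}"
    then obtain y where y: "y \<in> biset_fix Q \<gamma> \<beta> Y" "y \<in> biset_fix Q \<gamma>' \<beta> Y" by auto
    have "\<gamma> q = \<gamma>' q" if "q \<in> Q" for q
    proof (rule lact_left_cancel[OF grp Y])
      show "lact Y (\<gamma> q) y = lact Y (\<gamma>' q) y" "y \<in> points Y"
        using y that by (auto simp: biset_fix_def)
    qed (use g that in auto)
    then have "\<gamma> = \<gamma>'" using g by (intro PiE_ext) auto
    then show False using g by simp
  qed
  \<comment> \<open>The pairs \<open>(x, y)\<close> lying in fixed classes are counted twice: class
    by class, and according to the \<gamma> that they satisfy.\<close>
  have union: "(\<Union>z\<in>?fix. z) = (\<Union>\<gamma>\<in>Q \<rightarrow>\<^sub>E carrier H. ?D \<gamma>)"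
  proof (rule Set.set_eqI)
    fix w :: "'x \<times> 'y"
    obtain x y where w: "w = (x, y)" by (cases w)
    show "w \<in> (\<Union>z\<in>?fix. z) \<longleftrightarrow> w \<in> (\<Union>\<gamma>\<in>Q \<rightarrow>\<^sub>E carrier H. ?D \<gamma>)"
    proof
      assume "w \<in> (\<Union>z\<in>?fix. z)"
      then obtain z where z: "z \<in> ?fix" "w \<in> z" by auto
      then have "z \<in> points (biset_tensor H X Y)" by (simp add: biset_fix_def)
      note p = mem_tensor_pointD[OF this z(2)[unfolded w]]
      then show "w \<in> (\<Union>\<gamma>\<in>Q \<rightarrow>\<^sub>E carrier H. ?D \<gamma>)"
        using tensor_point_fixed_iff[OF p(1,2) assms(3,4)] z(1) w p(3) by auto
    next
      assume "w \<in> (\<Union>\<gamma>\<in>Q \<rightarrow>\<^sub>E carrier H. ?D \<gamma>)"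
      then obtain \<gamma> where g: "\<gamma> \<in> Q \<rightarrow>\<^sub>E carrier H" "x \<in> biset_fix Q \<alpha> \<gamma> X" "y \<in> biset_fix Q \<gamma> \<beta> Y"
        using w by auto
      then have p: "x \<in> points X" "y \<in> points Y" by (auto simp: biset_fix_def)
      then have "tensor_point H X Y x y \<in> ?fix"
        using tensor_point_fixed_iff[OF p assms(3,4)] g by blast
      then show "w \<in> (\<Union>z\<in>?fix. z)" using tensor_point_self[OF p] w by auto
    qed
  qed
  \<comment> \<open>Freeness on \<open>Y\<close> makes the parametrization of an orbit by
    \<open>H\<close> injective.\<close>
  have card_pt: "card z = card (carrier H)" if "z \<in> ?fix" for z
  proof -
    from that obtain x y where xy: "x \<in> points X" "y \<in> points Y" "z = tensor_point H X Y x y"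
      unfolding biset_fix_def points_tensor by auto
    have "inj_on (\<lambda>h. (ract X x (inv\<^bsub>H\<^esub> h), lact Y h y)) (carrier H)"
      by (rule inj_onI) (use lact_left_cancel[OF grp Y _ _ xy(2)] in auto)
    then show ?thesis unfolding xy(3) tensor_point_def by (rule card_image)
  qed
  have disj': "z \<inter> z' = {}" if "z \<in> ?fix" "z' \<in> ?fix" "z \<noteq> z'" for z z'
  proof (rule ccontr)
    assume "z \<inter> z' \<noteq> {}"
    then obtain x y where "(x, y) \<in> z" "(x, y) \<in> z'" by auto
    moreover have "z \<in> points (biset_tensor H X Y)" "z' \<in> points (biset_tensor H X Y)"
      using that by (auto simp: biset_fix_def)
    ultimately show False using mem_tensor_pointD(3) that by metis
  qed
  have finfix: "finite ?fix" by (rule finite_biset_fix) (rule left_free_bisetD[OF left_free_tensor])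
  have "card (\<Union>z\<in>?fix. z) = (\<Sum>z\<in>?fix. card z)"
    using disj' finfix assms(2)
    by (intro card_UN_disjoint) (auto simp: biset_fix_def points_tensor tensor_point_def)
  also have "\<dots> = card (carrier H) * card ?fix" by (simp add: card_pt)
  finally have "card (carrier H) * card ?fix = card (\<Union>\<gamma>\<in>Q \<rightarrow>\<^sub>E carrier H. ?D \<gamma>)"
    unfolding union by simp
  also have "\<dots> = (\<Sum>\<gamma>\<in>Q \<rightarrow>\<^sub>E carrier H. card (?D \<gamma>))"
    using finH disj XD(1) YD(1) by (intro card_UN_disjoint) (auto simp: finite_biset_fix)
  finally show ?thesis by (simp add: card_cartesian_product)
qed

end


text \<open>Applying both isomorphisms componentwise maps orbits onto orbits. This makes the
  composition of isomorphism classes independent of representatives.\<close>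

lemma biset_isomorphic_tensor:
  assumes "group G" "group H" "group K" "left_free_biset H K X" "left_free_biset H K X'"
    and "left_free_biset G H Y" "left_free_biset G H Y'"
    and "biset_isomorphic H K X X'" "biset_isomorphic G H Y Y'"
  shows "biset_isomorphic G K (biset_tensor H X Y) (biset_tensor H X' Y')"
proof -
  interpret T: tensor_bisets G H K X Y using assms by (intro tensor_bisets.intro)
  interpret T': tensor_bisets G H K X' Y' using assms by (intro tensor_bisets.intro)
  obtain f where f: "bij_betw f (points X) (points X')"
    "\<And>h x. h \<in> carrier K \<Longrightarrow> x \<in> points X \<Longrightarrow> f (lact X h x) = lact X' h (f x)"
    "\<And>x g. x \<in> points X \<Longrightarrow> g \<in> carrier H \<Longrightarrow> f (ract X x g) = ract X' (f x) g"
    using assms(8) unfolding biset_isomorphic_def by blast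
  obtain f' where f': "bij_betw f' (points Y) (points Y')"
    "\<And>h x. h \<in> carrier H \<Longrightarrow> x \<in> points Y \<Longrightarrow> f' (lact Y h x) = lact Y' h (f' x)"
    "\<And>x g. x \<in> points Y \<Longrightarrow> g \<in> carrier G \<Longrightarrow> f' (ract Y x g) = ract Y' (f' x) g"
    using assms(9) unfolding biset_isomorphic_def by blast
  have im: "f ` points X = points X'" "f' ` points Y = points Y'"
    and inj: "inj_on f (points X)" "inj_on f' (points Y)"
    using f(1) f'(1) by (auto simp: bij_betw_def)
  have mem: "f x \<in> points X'" if "x \<in> points X" for x using that im by auto
  have mem': "f' x \<in> points Y'" if "x \<in> points Y" for x using that im by auto
  let ?F = "(`) (map_prod f f')"
  have F: "?F (tensor_point H X Y x y) = tensor_point H X' Y' (f x) (f' y)"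
    if "x \<in> points X" "y \<in> points Y" for x y
    unfolding tensor_point_def image_image using that
    by (intro image_cong) (simp_all add: f f' T.XD T.YD)
  have "inj_on ?F (points (biset_tensor H X Y))"
  proof (rule inj_onI)
    fix z z' assume z: "z \<in> points (biset_tensor H X Y)" "z' \<in> points (biset_tensor H X Y)" "?F z = ?F z'"
    obtain x y where xy: "x \<in> points X" "y \<in> points Y" "z = tensor_point H X Y x y"
      using z(1) unfolding T.points_tensor by auto
    obtain x' y' where xy': "x' \<in> points X" "y' \<in> points Y" "z' = tensor_point H X Y x' y'"
      using z(2) unfolding T.points_tensor by auto
    have "tensor_point H X' Y' (f x) (f' y) = tensor_point H X' Y' (f x') (f' y')"
      using z(3) xy xy' F by simp
    then obtain h where h: "h \<in> carrier H" "f x = ract X' (f x') h" "lact Y' h (f' y) = f' y'"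
      using T'.tensor_point_eq_iff[of "f x" "f' y" "f x'" "f' y'"] xy xy' mem mem' by auto
    then have "f x = f (ract X x' h)" "f' (lact Y h y) = f' y'" using f(3) f'(2) xy xy' by auto
    then have "x = ract X x' h" "lact Y h y = y'"
      using inj xy xy' h(1) T.XD(5) T.YD(2) by (metis inj_onD)+
    then show "z = z'" using T.tensor_point_eq_iff xy xy' h(1) by blast
  qed
  moreover have "?F ` points (biset_tensor H X Y) = points (biset_tensor H X' Y')"
  proof
    show "?F ` points (biset_tensor H X Y) \<subseteq> points (biset_tensor H X' Y')"
      unfolding T.points_tensor T'.points_tensor using F mem mem' by auto blast
    show "points (biset_tensor H X' Y') \<subseteq> ?F ` points (biset_tensor H X Y)"
    proof
      fix z assume "z \<in> points (biset_tensor H X' Y')"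
      then obtain x y where xy: "x \<in> points X" "y \<in> points Y" "z = tensor_point H X' Y' (f x) (f' y)"
        unfolding T'.points_tensor im[symmetric] by blast
      show "z \<in> ?F ` points (biset_tensor H X Y)"
        unfolding xy(3) F[OF xy(1,2), symmetric] by (intro imageI) (use xy in \<open>auto simp: T.points_tensor\<close>)
    qed
  qed
  ultimately have "bij_betw ?F (points (biset_tensor H X Y)) (points (biset_tensor H X' Y'))"
    by (simp add: bij_betw_def)
  moreover have "?F (lact (biset_tensor H X Y) k z) = lact (biset_tensor H X' Y') k (?F z)"
    if "k \<in> carrier K" "z \<in> points (biset_tensor H X Y)" for k z
  proof -
    obtain x y where xy: "x \<in> points X" "y \<in> points Y" "z = tensor_point H X Y x y"
      using \<open>z \<in> _\<close> unfolding T.points_tensor by auto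
    show ?thesis
      using that(1) xy(1,2) unfolding xy(3)
      by (simp only: T.lact_tensor T'.lact_tensor F f mem T.XD)
  qed
  moreover have "?F (ract (biset_tensor H X Y) z g) = ract (biset_tensor H X' Y') (?F z) g"
    if "g \<in> carrier G" "z \<in> points (biset_tensor H X Y)" for g z
  proof -
    obtain x y where xy: "x \<in> points X" "y \<in> points Y" "z = tensor_point H X Y x y"
      using \<open>z \<in> _\<close> unfolding T.points_tensor by auto
    show ?thesis
      using that(1) xy(1,2) unfolding xy(3)
      by (simp only: T.ract_tensor T'.ract_tensor F f' mem' T.YD)
  qed
  ultimately show ?thesis unfolding biset_isomorphic_def by blast
qed

subsection \<open>Transitive bisets\<close>

text \<open>The biset of \<open>[D, \<phi>]\<close> is the tensor product over \<open>D\<close> of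
  this biset, for \<phi> defined on \<open>D\<close>, with \<open>group_biset G\<close>. Its
  freeness and its marks then follow from the results on tensor products.\<close>

definition hom_biset :: "'h monoid \<Rightarrow> ('k \<Rightarrow> 'h) \<Rightarrow> ('k, 'h, 'h) biset" where
  "hom_biset H \<phi> = \<lparr>points = carrier H, lact = monoid.mult H, ract = (\<lambda>h k. h \<otimes>\<^bsub>H\<^esub> \<phi> k)\<rparr>"

definition group_biset :: "'g monoid \<Rightarrow> ('g, 'g, 'g) biset" where
  "group_biset G = \<lparr>points = carrier G, lact = monoid.mult G, ract = monoid.mult G\<rparr>"

lemma left_free_hom_biset:
  assumes "group K" "group H" "\<phi> \<in> hom K H" "finite (carrier H)"
  shows "left_free_biset K H (hom_biset H \<phi>)"
proof -
  interpret H: group H by fact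
  interpret group_hom K H \<phi> using assms by (simp add: group_hom_def group_hom_axioms_def)
  show ?thesis
    unfolding left_free_biset_def hom_biset_def using assms(4)
    by (auto simp: H.m_assoc)
qed

lemma left_free_group_biset:
  assumes "group G" "subgroup K G" "finite (carrier G)"
  shows "left_free_biset G (G\<lparr>carrier := K\<rparr>) (group_biset G)"
proof -
  interpret G: group G by fact
  interpret subgroup K G by fact
  show ?thesis
    unfolding left_free_biset_def group_biset_def using assms(3)
    by (auto simp: G.m_assoc)
qed

locale transitive_biset_data =
  fixes G :: "'g monoid" and H :: "'h monoid" and D :: "'g set" and \<phi> :: "'g \<Rightarrow> 'h"
  assumes grpG: "group G" and grpH: "group H" and D: "subgroup D G"
    and hom: "\<phi> \<in> hom (G\<lparr>carrier := D\<rparr>) H" and finG: "finite (carrier G)" and finH: "finite (carrier H)"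
begin

sublocale G: group G by (rule grpG)

sublocale H: group H by (rule grpH)

sublocale T: tensor_bisets G "G\<lparr>carrier := D\<rparr>" H "hom_biset H \<phi>" "group_biset G"
  using grpG grpH D hom finG finH G.subgroup_imp_group[OF D]
  by (intro tensor_bisets.intro left_free_hom_biset left_free_group_biset) auto

text \<open>The two quotients use the same pairs, listed in opposite order. The orbit description
  shows that \<open>tensor_rel\<close> is symmetric, so the order is immaterial.\<close>

lemma transitive_biset_eq_tensor:
  "transitive_biset G H D \<phi> = biset_tensor (G\<lparr>carrier := D\<rparr>) (hom_biset H \<phi>) (group_biset G)"
proof -
  have "transitive_rel G H D \<phi> = tensor_rel (G\<lparr>carrier := D\<rparr>) (hom_biset H \<phi>) (group_biset G)"
    (is "?t = ?r")
  proof -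
    have conv: "?t = ?r\<inverse>"
      unfolding transitive_rel_def tensor_rel_def hom_biset_def group_biset_def by auto
    have "sym ?r"
    proof (rule symI)
      fix a b assume ab: "(a, b) \<in> ?r"
      obtain x y where a: "a = (x, y)" by (cases a)
      obtain x' y' where b: "b = (x', y')" by (cases b)
      have p: "x \<in> points (hom_biset H \<phi>)" "y \<in> points (group_biset G)"
        "x' \<in> points (hom_biset H \<phi>)" "y' \<in> points (group_biset G)"
        using ab T.XD(5) T.YD(2) unfolding tensor_rel_def a b by auto
      have "tensor_point (G\<lparr>carrier := D\<rparr>) (hom_biset H \<phi>) (group_biset G) x y =
          tensor_point (G\<lparr>carrier := D\<rparr>) (hom_biset H \<phi>) (group_biset G) x' y'"
        unfolding T.tensor_point_eq_iff[OF p]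
        using ab unfolding tensor_rel_def a b by auto
      then have "(x, y) \<in> ?r `` {(x', y')}"
        using T.tensor_rel_Image p T.tensor_point_self by metis
      then show "(b, a) \<in> ?r" using a b by auto
    qed
    then show ?thesis using conv by (simp add: sym_conv_converse_eq)
  qed
  then show ?thesis
    unfolding transitive_biset_def biset_tensor_def hom_biset_def group_biset_def by simp
qed

lemma left_free_transitive: "left_free_biset G H (transitive_biset G H D \<phi>)"
  unfolding transitive_biset_eq_tensor by (rule T.left_free_tensor)

text \<open>This is the tensor formula over \<open>D\<close>, with the fixed points of
  \<open>hom_biset\<close> and of \<open>group_biset\<close> written out.\<close>

lemma card_biset_fix_transitive:
  assumes "finite Q" "\<alpha> \<in> Q \<rightarrow> carrier H" "\<beta> \<in> Q \<rightarrow> carrier G"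
  shows "card D * card (biset_fix Q \<alpha> \<beta> (transitive_biset G H D \<phi>)) =
    (\<Sum>\<gamma>\<in>Q \<rightarrow>\<^sub>E D. card {h \<in> carrier H. \<forall>q\<in>Q. \<alpha> q \<otimes>\<^bsub>H\<^esub> h = h \<otimes>\<^bsub>H\<^esub> \<phi> (\<gamma> q)} *
      card {g \<in> carrier G. \<forall>q\<in>Q. \<gamma> q \<otimes>\<^bsub>G\<^esub> g = g \<otimes>\<^bsub>G\<^esub> \<beta> q})"
  using T.card_biset_fix_tensor[OF assms(1) _ assms(2,3)] finite_subset[OF subgroup.subset[OF D] finG]
  unfolding transitive_biset_eq_tensor by (simp add: biset_fix_def hom_biset_def group_biset_def)

text \<open>A nonzero sum leaves some \<gamma> with a witness \<open>h\<close> in the first factor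
  and \<open>g\<close> in the second. Solving the two intertwining equations identifies \<gamma>
  with the conjugate of \<beta> by \<open>g\<close> and expresses \<alpha> through \<phi>. In this
  way marks produce morphisms.\<close>

lemma biset_fix_transitive_nonempty:
  assumes "finite Q" "\<alpha> \<in> Q \<rightarrow> carrier H" "\<beta> \<in> Q \<rightarrow> carrier G"
    and "card (biset_fix Q \<alpha> \<beta> (transitive_biset G H D \<phi>)) \<noteq> 0"
  shows "\<exists>h\<in>carrier H. \<exists>g\<in>carrier G. \<forall>q\<in>Q. g \<otimes>\<^bsub>G\<^esub> \<beta> q \<otimes>\<^bsub>G\<^esub> inv\<^bsub>G\<^esub> g \<in> D \<and>
    \<alpha> q = h \<otimes>\<^bsub>H\<^esub> \<phi> (g \<otimes>\<^bsub>G\<^esub> \<beta> q \<otimes>\<^bsub>G\<^esub> inv\<^bsub>G\<^esub> g) \<otimes>\<^bsub>H\<^esub> inv\<^bsub>H\<^esub> h"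
proof -
  have "card D \<noteq> 0"
    using finite_subset[OF subgroup.subset[OF D] finG] subgroup.one_closed[OF D] by auto
  then have "card D * card (biset_fix Q \<alpha> \<beta> (transitive_biset G H D \<phi>)) \<noteq> 0" using assms by simp
  then obtain \<gamma> where "\<gamma> \<in> Q \<rightarrow>\<^sub>E D" "{h \<in> carrier H. \<forall>q\<in>Q. \<alpha> q \<otimes>\<^bsub>H\<^esub> h = h \<otimes>\<^bsub>H\<^esub> \<phi> (\<gamma> q)} \<noteq> {}"
    "{g \<in> carrier G. \<forall>q\<in>Q. \<gamma> q \<otimes>\<^bsub>G\<^esub> g = g \<otimes>\<^bsub>G\<^esub> \<beta> q} \<noteq> {}"
    unfolding card_biset_fix_transitive[OF assms(1-3)]
    by (metis (no_types, lifting) card.empty mult_0 mult_0_right sum.neutral)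
  then obtain h g where hg: "h \<in> carrier H" "g \<in> carrier G" "\<gamma> \<in> Q \<rightarrow>\<^sub>E D"
    "\<And>q. q \<in> Q \<Longrightarrow> \<alpha> q \<otimes>\<^bsub>H\<^esub> h = h \<otimes>\<^bsub>H\<^esub> \<phi> (\<gamma> q)" "\<And>q. q \<in> Q \<Longrightarrow> \<gamma> q \<otimes>\<^bsub>G\<^esub> g = g \<otimes>\<^bsub>G\<^esub> \<beta> q"
    by blast
  show ?thesis
  proof (intro bexI ballI)
    fix q assume q: "q \<in> Q"
    have m: "\<alpha> q \<in> carrier H" "\<beta> q \<in> carrier G" "\<gamma> q \<in> D" "\<gamma> q \<in> carrier G"
      using q assms hg(3) subgroup.mem_carrier[OF D] by auto
    have "g \<otimes>\<^bsub>G\<^esub> \<beta> q \<otimes>\<^bsub>G\<^esub> inv\<^bsub>G\<^esub> g = \<gamma> q"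
      using m hg q by (metis G.inv_solve_right G.m_closed)
    moreover have "\<phi> (\<gamma> q) \<in> carrier H" using hom m(3) by (auto simp: hom_def)
    then have "\<alpha> q = h \<otimes>\<^bsub>H\<^esub> \<phi> (\<gamma> q) \<otimes>\<^bsub>H\<^esub> inv\<^bsub>H\<^esub> h"
      using m hg q by (metis H.inv_solve_right H.m_closed)
    ultimately show "g \<otimes>\<^bsub>G\<^esub> \<beta> q \<otimes>\<^bsub>G\<^esub> inv\<^bsub>G\<^esub> g \<in> D \<and>
        \<alpha> q = h \<otimes>\<^bsub>H\<^esub> \<phi> (g \<otimes>\<^bsub>G\<^esub> \<beta> q \<otimes>\<^bsub>G\<^esub> inv\<^bsub>G\<^esub> g) \<otimes>\<^bsub>H\<^esub> inv\<^bsub>H\<^esub> h"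
      using m by simp
  qed (use hg in auto)
qed

end

text \<open>Substituting \<open>h\<close> by \<open>h \<phi>(g)\<close> removes the dependence on the second coordinate.\<close>

lemma card_biset_fix_transitive_full:
  assumes "transitive_biset_data G H (carrier G) \<phi>"
    and "finite Q" "\<alpha> \<in> Q \<rightarrow> carrier H" "\<beta> \<in> Q \<rightarrow> carrier G"
  shows "card (biset_fix Q \<alpha> \<beta> (transitive_biset G H (carrier G) \<phi>)) =
    card {h \<in> carrier H. \<forall>q\<in>Q. \<alpha> q \<otimes>\<^bsub>H\<^esub> h = h \<otimes>\<^bsub>H\<^esub> \<phi> (\<beta> q)}"
proof -
  interpret transitive_biset_data G H "carrier G" \<phi> by fact
  interpret phi: group_hom G H \<phi>
    using hom grpG grpH by (simp add: group_hom_def group_hom_axioms_def)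
  let ?h = "\<lambda>\<gamma>. {h \<in> carrier H. \<forall>q\<in>Q. \<alpha> q \<otimes>\<^bsub>H\<^esub> h = h \<otimes>\<^bsub>H\<^esub> \<phi> (\<gamma> q)}"
  let ?g = "\<lambda>\<gamma>. {g \<in> carrier G. \<forall>q\<in>Q. \<gamma> q \<otimes>\<^bsub>G\<^esub> g = g \<otimes>\<^bsub>G\<^esub> \<beta> q}"
  have h: "card (?h \<gamma>) = card (?h \<beta>)" if "\<gamma> \<in> Q \<rightarrow>\<^sub>E carrier G" "?g \<gamma> \<noteq> {}" for \<gamma>
  proof -
    from that obtain g where g: "g \<in> carrier G" "\<And>q. q \<in> Q \<Longrightarrow> \<gamma> q \<otimes>\<^bsub>G\<^esub> g = g \<otimes>\<^bsub>G\<^esub> \<beta> q" by blast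
    have phi_g: "\<phi> (\<gamma> q) \<otimes>\<^bsub>H\<^esub> \<phi> g = \<phi> g \<otimes>\<^bsub>H\<^esub> \<phi> (\<beta> q)" if "q \<in> Q" for q
      using g that assms(4) \<open>\<gamma> \<in> Q \<rightarrow>\<^sub>E carrier G\<close> by (metis PiE_mem Pi_mem phi.hom_mult)
    have iff: "h \<otimes>\<^bsub>H\<^esub> \<phi> g \<in> ?h \<beta> \<longleftrightarrow> h \<in> ?h \<gamma>" if hc: "h \<in> carrier H" for h
    proof -
      have "\<alpha> q \<otimes>\<^bsub>H\<^esub> (h \<otimes>\<^bsub>H\<^esub> \<phi> g) = (h \<otimes>\<^bsub>H\<^esub> \<phi> g) \<otimes>\<^bsub>H\<^esub> \<phi> (\<beta> q) \<longleftrightarrow> \<alpha> q \<otimes>\<^bsub>H\<^esub> h = h \<otimes>\<^bsub>H\<^esub> \<phi> (\<gamma> q)"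
        if q: "q \<in> Q" for q
      proof -
        have m: "\<alpha> q \<in> carrier H" "\<beta> q \<in> carrier G" "\<gamma> q \<in> carrier G" "\<phi> g \<in> carrier H"
          using q assms \<open>\<gamma> \<in> Q \<rightarrow>\<^sub>E carrier G\<close> g by auto
        have "(h \<otimes>\<^bsub>H\<^esub> \<phi> g) \<otimes>\<^bsub>H\<^esub> \<phi> (\<beta> q) = (h \<otimes>\<^bsub>H\<^esub> \<phi> (\<gamma> q)) \<otimes>\<^bsub>H\<^esub> \<phi> g"
          using m hc phi_g[OF q] by (simp add: H.m_assoc)
        moreover have "\<alpha> q \<otimes>\<^bsub>H\<^esub> (h \<otimes>\<^bsub>H\<^esub> \<phi> g) = (\<alpha> q \<otimes>\<^bsub>H\<^esub> h) \<otimes>\<^bsub>H\<^esub> \<phi> g"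
          using m hc by (simp add: H.m_assoc)
        ultimately show ?thesis using m hc by simp
      qed
      then show ?thesis using hc g by auto
    qed
    have "bij_betw (\<lambda>h. h \<otimes>\<^bsub>H\<^esub> \<phi> g) (?h \<gamma>) (?h \<beta>)"
    proof (rule bij_betw_byWitness[where f' = "\<lambda>h. h \<otimes>\<^bsub>H\<^esub> inv\<^bsub>H\<^esub> \<phi> g"])
      show "(\<lambda>h. h \<otimes>\<^bsub>H\<^esub> inv\<^bsub>H\<^esub> \<phi> g) ` ?h \<beta> \<subseteq> ?h \<gamma>"
      proof (rule image_subsetI)
        fix h assume h: "h \<in> ?h \<beta>"
        have "(h \<otimes>\<^bsub>H\<^esub> inv\<^bsub>H\<^esub> \<phi> g) \<otimes>\<^bsub>H\<^esub> \<phi> g = h"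
          using h g by (simp add: H.m_assoc)
        then show "h \<otimes>\<^bsub>H\<^esub> inv\<^bsub>H\<^esub> \<phi> g \<in> ?h \<gamma>"
          using iff[of "h \<otimes>\<^bsub>H\<^esub> inv\<^bsub>H\<^esub> \<phi> g"] h g by simp
      qed
    qed (use iff g in \<open>auto simp: H.m_assoc\<close>)
    then show ?thesis by (rule bij_betw_same_card)
  qed
  have g: "(\<Sum>\<gamma>\<in>Q \<rightarrow>\<^sub>E carrier G. card (?g \<gamma>)) = card (carrier G)"
    by (rule G.sum_card_intertwiners) (use assms finG in auto)
  have "card (carrier G) * card (biset_fix Q \<alpha> \<beta> (transitive_biset G H (carrier G) \<phi>)) =
      (\<Sum>\<gamma>\<in>Q \<rightarrow>\<^sub>E carrier G. card (?h \<gamma>) * card (?g \<gamma>))"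
    by (rule card_biset_fix_transitive[OF assms(2-4)])
  also have "\<dots> = (\<Sum>\<gamma>\<in>Q \<rightarrow>\<^sub>E carrier G. card (?h \<beta>) * card (?g \<gamma>))"
  proof (rule sum.cong[OF refl])
    fix \<gamma> assume \<gamma>: "\<gamma> \<in> Q \<rightarrow>\<^sub>E carrier G"
    show "card (?h \<gamma>) * card (?g \<gamma>) = card (?h \<beta>) * card (?g \<gamma>)"
    \<comment> \<open>If no \<open>g\<close> intertwines \<gamma> with \<beta>, the numbers of
      \<open>h\<close> cannot be compared, but both products vanish.\<close>
    proof (cases "?g \<gamma> = {}")
      case True
      show ?thesis unfolding True by simp
    next
      case False
      show ?thesis unfolding h[OF \<gamma> False] ..
    qed
  qed
  also have "\<dots> = card (carrier G) * card (?h \<beta>)"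
    unfolding sum_distrib_left[symmetric] g by (rule mult.commute)
  finally show ?thesis using finG G.one_closed by auto
qed

subsection \<open>Marks of formal combinations\<close>

definition lin_ext :: "('c \<Rightarrow> rat) \<Rightarrow> ('c \<Rightarrow>\<^sub>0 rat) \<Rightarrow> rat" where
  "lin_ext f x = (\<Sum>C\<in>Poly_Mapping.keys x. Poly_Mapping.lookup x C * f C)"

text \<open>A common finite index set lets combinations with different supports be added
  termwise.\<close>

lemma lin_ext_superset:
  assumes "finite A" "Poly_Mapping.keys x \<subseteq> A"
  shows "lin_ext f x = (\<Sum>C\<in>A. Poly_Mapping.lookup x C * f C)"
  unfolding lin_ext_def using assms
  by (intro sum.mono_neutral_left) (auto simp: in_keys_iff)

lemma lin_ext_zero [simp]: "lin_ext f 0 = 0"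
  by (simp add: lin_ext_def)

lemma lin_ext_add [simp]: "lin_ext f (x + y) = lin_ext f x + lin_ext f y"
proof -
  let ?A = "Poly_Mapping.keys x \<union> Poly_Mapping.keys y"
  have "Poly_Mapping.keys (x + y) \<subseteq> ?A" by (rule Poly_Mapping.keys_add)
  then show ?thesis
    by (simp add: lin_ext_superset[of ?A] lookup_add sum.distrib algebra_simps)
qed

lemma lin_ext_minus [simp]: "lin_ext f (x - y) = lin_ext f x - lin_ext f y"
  using lin_ext_add[of f "x - y" y] by simp

lemma lin_ext_single [simp]: "lin_ext f (Poly_Mapping.single C c) = c * f C"
  by (cases "c = 0") (auto simp: lin_ext_def)

lemma lin_ext_sum: "lin_ext f (sum g I) = (\<Sum>i\<in>I. lin_ext f (g i))"
  by (induction I rule: infinite_finite_induct) auto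

section \<open>Marks on isomorphism classes and on cosets\<close>

definition biset_classes :: "'g monoid \<Rightarrow> 'h monoid \<Rightarrow> ('g, 'h) biset_class set" where
  "biset_classes G H = {iso_class G H X | X :: ('g, 'h, nat) biset. left_free_biset G H X}"

text \<open>For an isomorphism class the chosen representative does not matter, since isomorphisms
  preserve the number of fixed points; see \<open>class_mark_iso_class\<close>. The values are
  rational to match the coefficients.\<close>

definition class_mark ::
  "'i set \<Rightarrow> ('i \<Rightarrow> 'h) \<Rightarrow> ('i \<Rightarrow> 'g) \<Rightarrow> ('g, 'h) biset_class \<Rightarrow> rat" where
  "class_mark Q \<alpha> \<beta> C = of_nat (card (biset_fix Q \<alpha> \<beta> (SOME X. X \<in> C)))"

abbreviation mark ::
  "'i set \<Rightarrow> ('i \<Rightarrow> 'h) \<Rightarrow> ('i \<Rightarrow> 'g) \<Rightarrow> ('g, 'h) formal_comb \<Rightarrow> rat" where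
  "mark Q \<alpha> \<beta> \<equiv> lin_ext (class_mark Q \<alpha> \<beta>)"

lemma iso_class_in_biset_classes:
  assumes "left_free_biset G H X"
  shows "iso_class G H X \<in> biset_classes G H"
  using exists_nat_biset[OF assms] iso_class_eqI[OF assms] unfolding biset_classes_def by blast

lemma class_mark_iso_class:
  assumes "left_free_biset G H X" "\<alpha> \<in> Q \<rightarrow> carrier H" "\<beta> \<in> Q \<rightarrow> carrier G"
  shows "class_mark Q \<alpha> \<beta> (iso_class G H X) = of_nat (card (biset_fix Q \<alpha> \<beta> X))"
proof -
  have "(SOME Y. Y \<in> iso_class G H X) \<in> iso_class G H X"
    unfolding some_in_eq using exists_nat_biset[OF assms(1)] by (auto simp: iso_class_def)
  then have "biset_isomorphic G H X (SOME Y. Y \<in> iso_class G H X)"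
    by (simp add: iso_class_def)
  from card_biset_fix_isomorphic[OF this assms(2,3,1)] show ?thesis
    unfolding class_mark_def by simp
qed

lemma class_mark_cong:
  assumes "\<And>q. q \<in> Q \<Longrightarrow> \<alpha> q = \<alpha>' q" "\<And>q. q \<in> Q \<Longrightarrow> \<beta> q = \<beta>' q"
  shows "class_mark Q \<alpha> \<beta> = class_mark Q \<alpha>' \<beta>'"
  unfolding class_mark_def using assms by (simp add: biset_fix_cong[of Q \<alpha> \<alpha>' \<beta> \<beta>'])

text \<open>\<open>class_comp\<close> is a union over all representatives. The classes in it agree
  by \<open>biset_isomorphic_tensor\<close>, and \<open>X\<close> and \<open>Y\<close> themselves
  show that the union is not empty, so it is a single isomorphism class.\<close>

lemma class_comp_iso_class:
  assumes "group G" "group H" "group K"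
    and "left_free_biset H K (X :: ('h, 'k, nat) biset)" "left_free_biset G H (Y :: ('g, 'h, nat) biset)"
  shows "class_comp G H K (iso_class H K X) (iso_class G H Y) = iso_class G K (biset_tensor H X Y)"
proof -
  have eq: "iso_class G K (biset_tensor H X' Y') = iso_class G K (biset_tensor H X Y)"
    if "X' \<in> iso_class H K X" "Y' \<in> iso_class G H Y" for X' Y'
  proof -
    have *: "left_free_biset H K X'" "left_free_biset G H Y'"
      "biset_isomorphic H K X X'" "biset_isomorphic G H Y Y'"
      using that by (auto simp: iso_class_def)
    show ?thesis
      using iso_class_eqI[OF tensor_bisets.left_free_tensor[OF tensor_bisets.intro[OF assms]]
        biset_isomorphic_tensor[OF assms(1-4) *(1) assms(5) *(2-4)]] by simp
  qed
  have "X \<in> iso_class H K X" "Y \<in> iso_class G H Y"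
    using assms biset_isomorphic_refl by (auto simp: iso_class_def)
  then show ?thesis unfolding class_comp_def using eq by blast
qed

text \<open>Relations involve only genuine isomorphism classes. Hence all representatives of a coset
  are supported on such classes as soon as one is, and the product formula applies to each of
  them.\<close>

lemma keys_burnside_relations:
  assumes "r \<in> burnside_relations p G H"
  shows "Poly_Mapping.keys r \<subseteq> biset_classes G H"
  using assms
proof induction
  case (add r c X Y)
  have *: "iso_class G H (biset_sum X Y) \<in> biset_classes G H" "iso_class G H X \<in> biset_classes G H"
    "iso_class G H Y \<in> biset_classes G H"
    using add by (auto intro: iso_class_in_biset_classes left_free_biset_sum)
  let ?s = "\<lambda>C. Poly_Mapping.single C c"
  let ?a = "?s (iso_class G H (biset_sum X Y))" and ?b = "?s (iso_class G H X)" and ?c = "?s (iso_class G H Y)"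
  have "Poly_Mapping.keys ?a \<subseteq> biset_classes G H" "Poly_Mapping.keys ?b \<subseteq> biset_classes G H"
    "Poly_Mapping.keys ?c \<subseteq> biset_classes G H"
    using * by simp_all
  then show ?case
    using add.IH keys_diff[of "?a - ?b" ?c] keys_diff[of ?a ?b] Poly_Mapping.keys_add[of r "?a - ?b - ?c"]
    by blast
qed simp

text \<open>Fixed points of a disjoint union are those of its two summands, so every generating
  relation has mark zero. This makes marks invariants of cosets.\<close>

lemma mark_burnside_relations:
  assumes "r \<in> burnside_relations p G H" "\<alpha> \<in> Q \<rightarrow> carrier H" "\<beta> \<in> Q \<rightarrow> carrier G"
  shows "mark Q \<alpha> \<beta> r = 0"
  using assms(1)
proof induction
  case (add r c X Y)
  have f: "finite (points X)" "finite (points Y)"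
    using add by (auto simp: left_free_biset_def)
  show ?case
    using add assms
    by (simp add: class_mark_iso_class left_free_biset_sum card_biset_fix_sum f algebra_simps)
qed simp

lemma burnside_coset_self: "x \<in> burnside_coset p G H x"
  by (simp add: burnside_coset_def burnside_relations.zero)

lemma keys_burnside_coset:
  assumes "y \<in> burnside_coset p G H x" "Poly_Mapping.keys x \<subseteq> biset_classes G H"
  shows "Poly_Mapping.keys y \<subseteq> biset_classes G H"
proof -
  have "Poly_Mapping.keys (x + (y - x)) \<subseteq> biset_classes G H"
    using assms keys_burnside_relations[of "y - x" p G H] Poly_Mapping.keys_add[of x "y - x"]
    by (auto simp: burnside_coset_def)
  then show ?thesis by simp
qed

lemma mark_burnside_coset:
  assumes "y \<in> burnside_coset p G H x" "\<alpha> \<in> Q \<rightarrow> carrier H" "\<beta> \<in> Q \<rightarrow> carrier G"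
  shows "mark Q \<alpha> \<beta> y = mark Q \<alpha> \<beta> x"
  using mark_burnside_relations[of "y - x" p G H \<alpha> Q \<beta>] assms by (simp add: burnside_coset_def)

lemma keys_formal_comp:
  assumes "group G" "group H" "group K"
    and "Poly_Mapping.keys x \<subseteq> biset_classes H K" "Poly_Mapping.keys y \<subseteq> biset_classes G H"
  shows "Poly_Mapping.keys (formal_comp G H K x y) \<subseteq> biset_classes G K"
proof -
  have "class_comp G H K C D \<in> biset_classes G K" if "C \<in> biset_classes H K" "D \<in> biset_classes G H" for C D
  proof -
    from that obtain X :: "('b, 'c, nat) biset" and Y :: "('a, 'b, nat) biset"
      where "C = iso_class H K X" "left_free_biset H K X"
        "D = iso_class G H Y" "left_free_biset G H Y"
      unfolding biset_classes_def by blast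
    then show ?thesis
      using assms(1-3) by (simp add: class_comp_iso_class iso_class_in_biset_classes
        tensor_bisets.left_free_tensor tensor_bisets.intro)
  qed
  then show ?thesis
    unfolding formal_comp_def using assms(4,5)
    by (auto dest!: set_mp[OF keys_sum] split: if_splits) blast
qed

text \<open>The bilinear extension of \<open>card_biset_fix_tensor\<close> from bisets to
  combinations; the chain of equations moves the sum over \<gamma> to the outside.\<close>

lemma mark_formal_comp:
  assumes "group G" "group H" "group K" "finite (carrier H)" "finite Q"
    and "Poly_Mapping.keys x \<subseteq> biset_classes H K" "Poly_Mapping.keys y \<subseteq> biset_classes G H"
    and "\<alpha> \<in> Q \<rightarrow> carrier K" "\<beta> \<in> Q \<rightarrow> carrier G"
  shows "of_nat (card (carrier H)) * mark Q \<alpha> \<beta> (formal_comp G H K x y) =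
    (\<Sum>\<gamma>\<in>Q \<rightarrow>\<^sub>E carrier H. mark Q \<alpha> \<gamma> x * mark Q \<gamma> \<beta> y)"
proof -
  have cls: "of_nat (card (carrier H)) * class_mark Q \<alpha> \<beta> (class_comp G H K C D) =
      (\<Sum>\<gamma>\<in>Q \<rightarrow>\<^sub>E carrier H. class_mark Q \<alpha> \<gamma> C * class_mark Q \<gamma> \<beta> D)"
    if "C \<in> biset_classes H K" "D \<in> biset_classes G H" for C D
  proof -
    from that obtain X :: "('b, 'c, nat) biset" and Y :: "('a, 'b, nat) biset"
      where XY: "C = iso_class H K X" "left_free_biset H K X"
        "D = iso_class G H Y" "left_free_biset G H Y"
      unfolding biset_classes_def by blast
    interpret T: tensor_bisets G H K X Y using assms XY by (intro tensor_bisets.intro)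
    have "of_nat (card (carrier H)) * class_mark Q \<alpha> \<beta> (class_comp G H K C D) =
        of_nat (card (carrier H) * card (biset_fix Q \<alpha> \<beta> (biset_tensor H X Y)))"
      unfolding XY class_comp_iso_class[OF assms(1-3) XY(2,4)]
      using assms by (simp add: class_mark_iso_class[OF T.left_free_tensor])
    also have "\<dots> = (\<Sum>\<gamma>\<in>Q \<rightarrow>\<^sub>E carrier H. class_mark Q \<alpha> \<gamma> C * class_mark Q \<gamma> \<beta> D)"
      unfolding T.card_biset_fix_tensor[OF assms(5,4,8,9)] of_nat_sum of_nat_mult XY
      by (intro sum.cong refl)
        (simp add: class_mark_iso_class[OF XY(2) assms(8)] class_mark_iso_class[OF XY(4) _ assms(9)]
          PiE_def)
    finally show ?thesis .
  qed
  let ?n = "of_nat (card (carrier H)) :: rat"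
  let ?kx = "Poly_Mapping.keys x" and ?ky = "Poly_Mapping.keys y"
  let ?lx = "Poly_Mapping.lookup x" and ?ly = "Poly_Mapping.lookup y"
  have "?n * mark Q \<alpha> \<beta> (formal_comp G H K x y) =
      (\<Sum>C\<in>?kx. \<Sum>D\<in>?ky. (?lx C * ?ly D) * (?n * class_mark Q \<alpha> \<beta> (class_comp G H K C D)))"
    unfolding formal_comp_def by (simp add: lin_ext_sum sum_distrib_left mult_ac)
  also have "\<dots> = (\<Sum>C\<in>?kx. \<Sum>D\<in>?ky. (?lx C * ?ly D) *
      (\<Sum>\<gamma>\<in>Q \<rightarrow>\<^sub>E carrier H. class_mark Q \<alpha> \<gamma> C * class_mark Q \<gamma> \<beta> D))"
    using assms(6,7) by (intro sum.cong refl) (simp add: cls subset_iff)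
  also have "\<dots> = (\<Sum>C\<in>?kx. \<Sum>D\<in>?ky. \<Sum>\<gamma>\<in>Q \<rightarrow>\<^sub>E carrier H.
      (?lx C * class_mark Q \<alpha> \<gamma> C) * (?ly D * class_mark Q \<gamma> \<beta> D))"
    by (simp add: sum_distrib_left mult_ac)
  also have "\<dots> = (\<Sum>C\<in>?kx. \<Sum>\<gamma>\<in>Q \<rightarrow>\<^sub>E carrier H. \<Sum>D\<in>?ky.
      (?lx C * class_mark Q \<alpha> \<gamma> C) * (?ly D * class_mark Q \<gamma> \<beta> D))"
    by (rule sum.cong[OF refl], rule sum.swap)
  also have "\<dots> = (\<Sum>\<gamma>\<in>Q \<rightarrow>\<^sub>E carrier H. \<Sum>C\<in>?kx. \<Sum>D\<in>?ky.
      (?lx C * class_mark Q \<alpha> \<gamma> C) * (?ly D * class_mark Q \<gamma> \<beta> D))"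
    by (rule sum.swap)
  also have "\<dots> = (\<Sum>\<gamma>\<in>Q \<rightarrow>\<^sub>E carrier H. mark Q \<alpha> \<gamma> x * mark Q \<gamma> \<beta> y)"
    unfolding lin_ext_def by (simp add: sum_product)
  finally show ?thesis .
qed

text \<open>Right translation by \<open>s\<close> is a bijection between the two fixed point sets of
  each biset.\<close>

lemma mark_conj_right:
  assumes "group G" "Poly_Mapping.keys x \<subseteq> biset_classes G H" "\<alpha> \<in> Q \<rightarrow> carrier H"
    and "\<gamma> \<in> Q \<rightarrow> carrier G" "\<gamma>' \<in> Q \<rightarrow> carrier G" "s \<in> carrier G"
    and "\<And>q. q \<in> Q \<Longrightarrow> \<gamma> q \<otimes>\<^bsub>G\<^esub> s = s \<otimes>\<^bsub>G\<^esub> \<gamma>' q"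
  shows "mark Q \<alpha> \<gamma> x = mark Q \<alpha> \<gamma>' x"
proof -
  interpret G: group G by fact
  have "class_mark Q \<alpha> \<gamma> C = class_mark Q \<alpha> \<gamma>' C" if C: "C \<in> biset_classes G H" for C
  proof -
    from C obtain X :: "('a, 'b, nat) biset" where X: "left_free_biset G H X" "C = iso_class G H X"
      unfolding biset_classes_def by blast
    note XD = left_free_bisetD[OF X(1)]
    \<comment> \<open>Stated for arbitrary \<open>s\<close> so that it serves for the given element
      and, with the two maps exchanged, for its inverse.\<close>
    have sub: "(\<lambda>x. ract X x s) ` biset_fix Q \<alpha> \<gamma> X \<subseteq> biset_fix Q \<alpha> \<gamma>' X"
      if "s \<in> carrier G" "\<gamma> \<in> Q \<rightarrow> carrier G" "\<gamma>' \<in> Q \<rightarrow> carrier G"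
        and gs: "\<And>q. q \<in> Q \<Longrightarrow> \<gamma> q \<otimes>\<^bsub>G\<^esub> s = s \<otimes>\<^bsub>G\<^esub> \<gamma>' q"
      for s \<gamma> \<gamma>'
    proof (rule image_subsetI)
      fix x assume x: "x \<in> biset_fix Q \<alpha> \<gamma> X"
      have "lact X (\<alpha> q) (ract X x s) = ract X (ract X x s) (\<gamma>' q)" if q: "q \<in> Q" for q
      proof -
        have m: "\<alpha> q \<in> carrier H" "\<gamma> q \<in> carrier G" "\<gamma>' q \<in> carrier G" "x \<in> points X"
          "lact X (\<alpha> q) x = ract X x (\<gamma> q)"
          using q x assms \<open>\<gamma> \<in> Q \<rightarrow> carrier G\<close> \<open>\<gamma>' \<in> Q \<rightarrow> carrier G\<close> by (auto simp: biset_fix_def)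
        have "lact X (\<alpha> q) (ract X x s) = ract X (lact X (\<alpha> q) x) s"
          using XD(8)[OF m(1,4) \<open>s \<in> carrier G\<close>] by simp
        also have "\<dots> = ract X x (\<gamma> q \<otimes>\<^bsub>G\<^esub> s)" using m \<open>s \<in> carrier G\<close> XD(7) by simp
        also have "\<dots> = ract X (ract X x s) (\<gamma>' q)" unfolding gs[OF q] using m \<open>s \<in> carrier G\<close> XD(7) by simp
        finally show ?thesis .
      qed
      then show "ract X x s \<in> biset_fix Q \<alpha> \<gamma>' X"
        using x \<open>s \<in> carrier G\<close> XD(5) by (auto simp: biset_fix_def)
    qed
    have "bij_betw (\<lambda>x. ract X x s) (biset_fix Q \<alpha> \<gamma> X) (biset_fix Q \<alpha> \<gamma>' X)"
    proof (rule bij_betw_byWitness[where f' = "\<lambda>x. ract X x (inv\<^bsub>G\<^esub> s)"])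
      show "(\<lambda>x. ract X x (inv\<^bsub>G\<^esub> s)) ` biset_fix Q \<alpha> \<gamma>' X \<subseteq> biset_fix Q \<alpha> \<gamma> X"
      proof (rule sub)
        fix q assume q: "q \<in> Q"
        have m: "\<gamma> q \<in> carrier G" "\<gamma>' q \<in> carrier G" using q assms by auto
        have "inv\<^bsub>G\<^esub> s \<otimes>\<^bsub>G\<^esub> (\<gamma> q \<otimes>\<^bsub>G\<^esub> s) = \<gamma>' q"
          unfolding assms(7)[OF q] using m assms(6) by (simp add: G.m_assoc[symmetric])
        then show "\<gamma>' q \<otimes>\<^bsub>G\<^esub> inv\<^bsub>G\<^esub> s = inv\<^bsub>G\<^esub> s \<otimes>\<^bsub>G\<^esub> \<gamma> q"
          using m assms(6) by (simp add: G.inv_solve_right' G.m_assoc)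
      qed (use assms in auto)
    qed (use assms sub[OF assms(6,4,5,7)] in \<open>auto simp: biset_fix_def XD(6) XD(7)[symmetric]\<close>)
    then show ?thesis
      unfolding X(2) using assms by (simp add: class_mark_iso_class[OF X(1)] bij_betw_same_card)
  qed
  then show ?thesis unfolding lin_ext_def using assms(2) by (intro sum.cong) auto
qed

text \<open>Only those \<gamma> contribute that are conjugate in \<open>H\<close> to the composite
  of \<beta> and \<phi>. On them the mark of \<open>x\<close> is constant by
  \<open>mark_conj_right\<close>, and the remaining counts add up to the order of \<open>H\<close>,
  which cancels.\<close>

lemma mark_comp_hom:
  assumes "transitive_biset_data G H (carrier G) \<phi>" "group K" "finite Q"
    and "Poly_Mapping.keys x \<subseteq> biset_classes H K"
    and "\<alpha> \<in> Q \<rightarrow> carrier K" "\<beta> \<in> Q \<rightarrow> carrier G"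
    and "y \<in> basis_elem p G H (carrier G) \<phi>"
    and "u \<in> burnside_coset p G K (formal_comp G H K x y)"
  shows "mark Q \<alpha> \<beta> u = mark Q \<alpha> (\<lambda>q. \<phi> (\<beta> q)) x"
proof -
  interpret transitive_biset_data G H "carrier G" \<phi> by fact
  let ?X = "transitive_biset G H (carrier G) \<phi>"
  let ?A = "\<lambda>\<gamma>. {h \<in> carrier H. \<forall>q\<in>Q. \<gamma> q \<otimes>\<^bsub>H\<^esub> h = h \<otimes>\<^bsub>H\<^esub> \<phi> (\<beta> q)}"
  have phi: "\<phi> (\<beta> q) \<in> carrier H" if "q \<in> Q" for q
    using that hom assms(6) by (auto simp: hom_def)
  have y: "Poly_Mapping.keys y \<subseteq> biset_classes G H"
    using iso_class_in_biset_classes[OF left_free_transitive]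
    by (intro keys_burnside_coset[OF assms(7)[unfolded basis_elem_def]]) simp
  have my: "mark Q \<gamma> \<beta> y = of_nat (card (?A \<gamma>))" if "\<gamma> \<in> Q \<rightarrow>\<^sub>E carrier H" for \<gamma>
  proof -
    have g: "\<gamma> \<in> Q \<rightarrow> carrier H" using that by (simp add: PiE_def)
    show ?thesis
      using mark_burnside_coset[OF assms(7)[unfolded basis_elem_def] g assms(6)]
        card_biset_fix_transitive_full[OF assms(1,3) g assms(6)]
      by (simp add: class_mark_iso_class[OF left_free_transitive g assms(6)])
  qed
  have cardA: "(\<Sum>\<gamma>\<in>Q \<rightarrow>\<^sub>E carrier H. card (?A \<gamma>)) = card (carrier H)"
    by (rule H.sum_card_intertwiners[OF assms(3) finH]) (use phi in auto)
  have "of_nat (card (carrier H)) * mark Q \<alpha> \<beta> u =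
      (\<Sum>\<gamma>\<in>Q \<rightarrow>\<^sub>E carrier H. mark Q \<alpha> \<gamma> x * mark Q \<gamma> \<beta> y)"
    using mark_formal_comp[OF grpG grpH assms(2) finH assms(3,4) y assms(5,6)]
      mark_burnside_coset[OF assms(8,5,6)] by simp
  also have "\<dots> = (\<Sum>\<gamma>\<in>Q \<rightarrow>\<^sub>E carrier H. mark Q \<alpha> (\<lambda>q. \<phi> (\<beta> q)) x * of_nat (card (?A \<gamma>)))"
  proof (rule sum.cong[OF refl])
    fix \<gamma> assume g: "\<gamma> \<in> Q \<rightarrow>\<^sub>E carrier H"
    show "mark Q \<alpha> \<gamma> x * mark Q \<gamma> \<beta> y = mark Q \<alpha> (\<lambda>q. \<phi> (\<beta> q)) x * of_nat (card (?A \<gamma>))"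
    proof (cases "?A \<gamma> = {}")
      case True
      show ?thesis unfolding my[OF g] True by simp
    next
      case False
      then obtain s where s: "s \<in> carrier H" "\<And>q. q \<in> Q \<Longrightarrow> \<gamma> q \<otimes>\<^bsub>H\<^esub> s = s \<otimes>\<^bsub>H\<^esub> \<phi> (\<beta> q)" by blast
      have "mark Q \<alpha> \<gamma> x = mark Q \<alpha> (\<lambda>q. \<phi> (\<beta> q)) x"
        using g phi by (intro mark_conj_right[OF grpH assms(4,5) _ _ s]) (auto simp: PiE_def)
      then show ?thesis by (simp add: my[OF g])
    qed
  qed
  also have "\<dots> = mark Q \<alpha> (\<lambda>q. \<phi> (\<beta> q)) x * of_nat (\<Sum>\<gamma>\<in>Q \<rightarrow>\<^sub>E carrier H. card (?A \<gamma>))"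
    by (simp only: sum_distrib_left[symmetric] of_nat_sum)
  also have "\<dots> = of_nat (card (carrier H)) * mark Q \<alpha> (\<lambda>q. \<phi> (\<beta> q)) x"
    unfolding cardA by simp
  finally show ?thesis using finH H.one_closed by auto
qed

subsection \<open>Actions of \<open>p\<close>-groups on cosets\<close>

text \<open>An orbit is either a single fixed point, contributing nothing, or it contains no fixed
  point and its size is a power of \<open>p\<close> other than 1. The claim follows by summing over
  orbits.\<close>

lemma (in group_action) p_dvd_card_not_fixed:
  assumes "prime p" "order G = p ^ n" "finite E"
  shows "p dvd card {x \<in> E. \<exists>g\<in>carrier G. \<phi> g x \<noteq> x}"
proof -
  let ?fixed = "\<lambda>x. \<forall>g\<in>carrier G. \<phi> g x = x"
  have orbit_fixed: "orbit G \<phi> x = {x}" if "x \<in> E" "?fixed x" for x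
    using that orbit_refl[of x] by (auto simp: orbit_def)
  have "p dvd (\<Sum>x\<in>A. if \<not> ?fixed x then 1 else 0)" if A: "A \<in> orbits G E \<phi>" for A
  proof -
    from A obtain x where x: "x \<in> E" "A = orbit G \<phi> x" by (auto simp: orbits_def)
    show ?thesis
    proof (cases "?fixed x")
      case True
      then show ?thesis using x orbit_fixed by simp
    next
      case False
      have AE: "A \<subseteq> E" using x element_image unfolding orbit_def by auto
      have nf: "\<not> ?fixed y" if "y \<in> A" for y
      proof
        assume "?fixed y"
        then have "x \<in> {y}" using orbit_fixed[of y] orbit_sym[OF x(1), of y] that AE x(2) by auto
        then show False using False \<open>?fixed y\<close> by simp
      qed
      have "card A dvd p ^ n" using orbit_stabilizer_theorem[OF x(1)] assms(2) x(2) by (metis dvd_triv_left)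
      moreover have "card A \<noteq> 1"
      proof
        assume "card A = 1"
        then obtain a where "A = {a}" by (auto simp: card_1_singleton_iff)
        moreover have "x \<in> A" using x orbit_refl by simp
        moreover from False obtain g where "g \<in> carrier G" "\<phi> g x \<noteq> x" by auto
        then have "\<phi> g x \<in> A" "\<phi> g x \<noteq> x" using x(2) unfolding orbit_def by auto
        ultimately show False by auto
      qed
      ultimately have "p dvd card A"
        using divides_primepow_nat[OF assms(1), of "card A" n] by (metis dvd_power gr_zeroI power_0)
      moreover have "(\<Sum>x\<in>A. if \<not> ?fixed x then 1 else 0) = card A"
        using nf by (simp cong: sum.cong)
      ultimately show ?thesis by simp
    qed
  qed
  then have "p dvd (\<Sum>A\<in>orbits G E \<phi>. \<Sum>x\<in>A. if \<not> ?fixed x then 1 else 0)"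
    by (rule dvd_sum)
  also have "\<dots> = (\<Sum>x\<in>E. if \<not> ?fixed x then 1 else 0)"
    by (rule disjoint_sum[OF assms(3)])
  also have "\<dots> = card {x \<in> E. \<exists>g\<in>carrier G. \<phi> g x \<noteq> x}"
    using card_as_sums[OF _ assms(3), of _ "\<lambda>x. \<exists>g\<in>carrier G. \<phi> g x \<noteq> x"] by simp
  finally show ?thesis .
qed

text \<open>The inverse turns right translation into a left action, and the restriction makes the
  maps extensional, as \<open>Bij\<close> demands.\<close>

lemma (in group) group_action_rcosets:
  assumes E: "subgroup E G" and Q: "subgroup Q G"
  shows "group_action (G\<lparr>carrier := Q\<rparr>) (rcosets E) (\<lambda>q. \<lambda>M\<in>rcosets E. M #> inv q)"
proof -
  let ?f = "\<lambda>q. \<lambda>M\<in>rcosets E. M #> inv q"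
  have sub: "M \<subseteq> carrier G" if "M \<in> rcosets E" for M
    using that E rcosets_subset_PowG by blast
  have Qc: "q \<in> carrier G" if "q \<in> Q" for q using that Q subgroup.mem_carrier by fast
  have clos: "M #> g \<in> rcosets E" if "M \<in> rcosets E" "g \<in> carrier G" for M g
  proof -
    from that obtain x where "x \<in> carrier G" "M = E #> x" by (auto simp: RCOSETS_def)
    then show ?thesis
      using that(2) subgroup.subset[OF E] by (simp add: coset_mult_assoc rcosetsI)
  qed
  have bij: "?f q \<in> Bij (rcosets E)" if "q \<in> Q" for q
  proof -
    have "bij_betw (?f q) (rcosets E) (rcosets E)"
      by (rule bij_betw_byWitness[where f' = "\<lambda>M. M #> q"])
        (use Qc[OF that] in \<open>auto simp: clos coset_mult_assoc sub\<close>)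
    then show ?thesis by (simp add: Bij_def)
  qed
  have "?f (q \<otimes> r) = compose (rcosets E) (?f q) (?f r)" if "q \<in> Q" "r \<in> Q" for q r
    using that Qc by (auto simp: compose_def fun_eq_iff clos coset_mult_assoc sub inv_mult_group)
  then have "?f \<in> hom (G\<lparr>carrier := Q\<rparr>) (BijGroup (rcosets E))"
    using bij by (auto simp: hom_def BijGroup_def)
  then show ?thesis
    using subgroup_imp_group[OF Q]
    by (simp add: group_action_def group_hom_def group_hom_axioms_def group_BijGroup)
qed

text \<open>The coset \<open>E #> h\<close> is fixed by \<open>Q\<close> iff \<open>h\<close>
  conjugates \<open>Q\<close> into \<open>E\<close>. So the set is the disjoint union of the fixed
  cosets; \<open>m\<close> is their number, and the number of the other cosets is divisible by
  \<open>p\<close>.\<close>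

lemma (in group) card_subconjugators:
  assumes "prime p" "order G = p ^ n" "finite (carrier G)" "subgroup E G" "subgroup Q G"
  shows "\<exists>m k. card {h \<in> carrier G. \<forall>q\<in>Q. h \<otimes> q \<otimes> inv h \<in> E} = card E * m \<and>
    card (rcosets E) = m + p * k"
proof -
  let ?f = "\<lambda>q. \<lambda>M\<in>rcosets E. M #> inv q"
  let ?A = "{h \<in> carrier G. \<forall>q\<in>Q. h \<otimes> q \<otimes> inv h \<in> E}"
  let ?fix = "{M \<in> rcosets E. \<forall>q\<in>Q. M #> inv q = M}"
  interpret act: group_action "G\<lparr>carrier := Q\<rparr>" "rcosets E" ?f
    using assms by (intro group_action_rcosets)
  have "card Q dvd p ^ n"
    using lagrange[OF assms(5)] assms(2) by (metis dvd_triv_right)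
  then have "order (G\<lparr>carrier := Q\<rparr>) dvd p ^ n" by (simp add: order_def)
  then obtain l where l: "order (G\<lparr>carrier := Q\<rparr>) = p ^ l"
    using divides_primepow_nat[OF assms(1)] by blast
  have fin: "finite (rcosets E)"
    using assms rcosets_subset_PowG finite_subset by blast
  have "p dvd card {M \<in> rcosets E. \<exists>q\<in>Q. ?f q M \<noteq> M}"
    using act.p_dvd_card_not_fixed[OF assms(1) l fin] by simp
  also have "{M \<in> rcosets E. \<exists>q\<in>Q. ?f q M \<noteq> M} = rcosets E - ?fix" by auto
  finally obtain k where k: "card (rcosets E - ?fix) = p * k" by auto
  have "rcosets E \<inter> ?fix = ?fix" by blast
  then have 1: "card (rcosets E) = card ?fix + p * k"
    using card_Int_Diff[OF fin, of ?fix] k by simp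
  have fixed_iff: "E #> h \<in> ?fix \<longleftrightarrow> h \<in> ?A" if h: "h \<in> carrier G" for h
  proof -
    have "E #> h #> inv q = E #> h \<longleftrightarrow> h \<otimes> q \<otimes> inv h \<in> E" if "q \<in> Q" for q
    proof -
      have q: "q \<in> carrier G" using that assms(5) subgroup.mem_carrier by fast
      have sub: "E \<subseteq> carrier G" using assms(4) by (rule subgroup.subset)
      \<comment> \<open>The action involves \<open>inv q\<close>, so the coset equation speaks of
        the conjugate of \<open>inv q\<close>; closure of \<open>E\<close> under inverses passes to
        \<open>q\<close>.\<close>
      let ?x = "h \<otimes> inv q \<otimes> inv h"
      have x: "?x \<in> carrier G" using h q by simp
      have "E #> h #> inv q = E #> h \<longleftrightarrow> E #> ?x = E"
        using coset_mult_inv1[of E "h \<otimes> inv q" h] coset_mult_inv2[of E "h \<otimes> inv q" h]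
          coset_mult_assoc[OF sub h, of "inv q"] h q sub by auto
      also have "\<dots> \<longleftrightarrow> ?x \<in> E"
        using coset_join1[OF _ x assms(4)] coset_join2[OF x assms(4)] by blast
      also have "\<dots> \<longleftrightarrow> inv ?x \<in> E"
        using subgroup.m_inv_closed[OF assms(4), of ?x] subgroup.m_inv_closed[OF assms(4), of "inv ?x"] x
        by auto
      also have "inv ?x = h \<otimes> q \<otimes> inv h"
        using h q by (simp add: inv_mult_group m_assoc)
      finally show ?thesis .
    qed
    then show ?thesis using h rcosetsI[OF subgroup.subset[OF assms(4)] h] by auto
  qed
  have union: "?A = \<Union>?fix"
  proof
    show "?A \<subseteq> \<Union>?fix"
    proof
      fix h assume h: "h \<in> ?A"
      then have "E #> h \<in> ?fix" using fixed_iff[of h] by blast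
      then show "h \<in> \<Union>?fix" using rcos_self[of h E] h assms(4) by blast
    qed
    show "\<Union>?fix \<subseteq> ?A"
    proof
      fix h assume "h \<in> \<Union>?fix"
      then obtain M where M: "M \<in> ?fix" "h \<in> M" by blast
      then obtain x where x: "x \<in> carrier G" "M = E #> x" by (auto simp: RCOSETS_def)
      then have "M = E #> h" using M repr_independence[of h E x] assms(4) by simp
      moreover have "h \<in> carrier G" using M rcosets_subset_PowG[OF assms(4)] by auto
      ultimately show "h \<in> ?A" using fixed_iff M by simp
    qed
  qed
  have "card E * card ?fix = card (\<Union>?fix)"
  proof (rule card_partition)
    show "\<And>M N. M \<in> ?fix \<Longrightarrow> N \<in> ?fix \<Longrightarrow> M \<noteq> N \<Longrightarrow> M \<inter> N = {}"
      using rcos_disjoint[OF assms(4)] by (auto simp: pairwise_def disjnt_def)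
    show "finite (\<Union>?fix)" unfolding union[symmetric] using assms(3) by simp
    show "\<And>M. M \<in> ?fix \<Longrightarrow> card M = card E"
      using card_rcosets_equal[OF _ subgroup.subset[OF assms(4)], symmetric] by blast
  qed (use fin in simp)
  then have "card ?A = card E * card ?fix" unfolding union by simp
  with 1 show ?thesis by blast
qed

subsection \<open>Fusion systems\<close>

locale fusion =
  fixes S :: "'a monoid" and F :: "'a hom_sets"
  assumes grp: "group S" and fus: "fusion_system S F"
begin

sublocale S: group S by (rule grp)

lemma Hom_grp_subset: "subgroup P S \<Longrightarrow> subgroup Q S \<Longrightarrow> Hom_grp S P Q \<subseteq> F P Q"
  using fus unfolding fusion_system_def by blast

lemma F_subset_Inj: "subgroup P S \<Longrightarrow> subgroup Q S \<Longrightarrow> F P Q \<subseteq> Inj S P Q"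
  using fus unfolding fusion_system_def by blast

lemma compose_closed:
  "subgroup P S \<Longrightarrow> subgroup Q S \<Longrightarrow> subgroup R S \<Longrightarrow> \<phi> \<in> F P Q \<Longrightarrow> \<psi> \<in> F Q R \<Longrightarrow>
    compose P \<psi> \<phi> \<in> F P R"
  using fus unfolding fusion_system_def by blast

lemma conj_map_in_F:
  assumes "subgroup P S" "subgroup Q S" "g \<in> carrier S"
    and "\<And>x. x \<in> P \<Longrightarrow> g \<otimes>\<^bsub>S\<^esub> x \<otimes>\<^bsub>S\<^esub> inv\<^bsub>S\<^esub> g \<in> Q"
  shows "conj_map S g P \<in> F P Q"
proof -
  have "conj_map S g P \<in> Hom_grp S P Q"
    using assms unfolding Hom_grp_def conj_map_def by auto
  then show ?thesis using Hom_grp_subset assms by blast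
qed

lemma inclusion_in_F:
  assumes "subgroup P S" "subgroup Q S" "P \<subseteq> Q"
  shows "(\<lambda>x\<in>P. x) \<in> F P Q"
proof -
  have "conj_map S \<one>\<^bsub>S\<^esub> P \<in> F P Q"
    using assms subgroup.mem_carrier[OF assms(1)] by (intro conj_map_in_F) auto
  moreover have "conj_map S \<one>\<^bsub>S\<^esub> P = (\<lambda>x\<in>P. x)"
    using subgroup.mem_carrier[OF assms(1)] by (auto simp: conj_map_def)
  ultimately show ?thesis by simp
qed

lemma F_D:
  assumes "subgroup P S" "subgroup Q S" "\<phi> \<in> F P Q"
  shows "\<phi> \<in> P \<rightarrow>\<^sub>E Q" "inj_on \<phi> P" "\<phi> \<in> hom (S\<lparr>carrier := P\<rparr>) S"
proof -
  have "\<phi> \<in> Inj S P Q" using F_subset_Inj assms by blast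
  then show "\<phi> \<in> P \<rightarrow>\<^sub>E Q" "inj_on \<phi> P" "\<phi> \<in> hom (S\<lparr>carrier := P\<rparr>) S"
    using subgroup.subset[OF assms(2)] by (auto simp: Inj_def hom_def PiE_def)
qed

text \<open>The axiom supplies an isomorphism onto some \<open>R\<close> followed by an inclusion.
  Invertibility forces \<open>R\<close> to be the image and the categorical inverse to be the
  set-theoretic one.\<close>

lemma morphism_factorization:
  assumes "subgroup P S" "subgroup Q S" "\<phi> \<in> F P Q"
  shows "subgroup (\<phi> ` P) S" "\<phi> \<in> F P (\<phi> ` P)" "(\<lambda>y\<in>\<phi> ` P. inv_into P \<phi> y) \<in> F (\<phi> ` P) P"
proof -
  obtain R \<alpha> where R: "subgroup R S" "R \<subseteq> Q" "cat_iso F P R \<alpha>" "\<phi> = compose P (\<lambda>x\<in>R. x) \<alpha>"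
    using fus assms unfolding fusion_system_def by meson
  obtain \<psi> where \<psi>: "\<alpha> \<in> F P R" "\<psi> \<in> F R P" "compose P \<psi> \<alpha> = (\<lambda>x\<in>P. x)" "compose R \<alpha> \<psi> = (\<lambda>x\<in>R. x)"
    using R(3) unfolding cat_iso_def by blast
  note a = F_D[OF assms(1) R(1) \<psi>(1)] and b = F_D[OF R(1) assms(1) \<psi>(2)]
  \<comment> \<open>Morphisms do not store a codomain, so composing with the inclusion leaves the
    function unchanged.\<close>
  have eq: "\<phi> = \<alpha>"
    unfolding R(4) by (rule extensionalityI[of _ P]) (use a in \<open>auto simp: compose_def PiE_def\<close>)
  have "\<alpha> (\<psi> y) = y" if "y \<in> R" for y
    using that fun_cong[OF \<psi>(4), of y] by (simp add: compose_def)
  then have im: "\<alpha> ` P = R" using a(1) b(1) by (force simp: PiE_def)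
  have "(\<lambda>y\<in>R. inv_into P \<alpha> y) = \<psi>"
  proof (rule extensionalityI[of _ R])
    fix y assume y: "y \<in> R"
    then have "\<psi> y \<in> P" "\<alpha> (\<psi> y) = y"
      using b(1) fun_cong[OF \<psi>(4), of y] by (auto simp: compose_def)
    then show "(\<lambda>y\<in>R. inv_into P \<alpha> y) y = \<psi> y" using y a(2) by (simp, metis inv_into_f_f)
  qed (use b in \<open>auto simp: PiE_def\<close>)
  then show "subgroup (\<phi> ` P) S" "\<phi> \<in> F P (\<phi> ` P)" "(\<lambda>y\<in>\<phi> ` P. inv_into P \<phi> y) \<in> F (\<phi> ` P) P"
    unfolding eq im using R \<psi> by simp_all
qed

text \<open>The function factors through its image, which is then included into
  \<open>R\<close>.\<close>

lemma change_codomain: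
  assumes "subgroup P S" "subgroup Q S" "subgroup R S" "\<phi> \<in> F P Q" "\<phi> ` P \<subseteq> R"
  shows "\<phi> \<in> F P R"
proof -
  note f = morphism_factorization[OF assms(1,2,4)]
  have "compose P (\<lambda>x\<in>\<phi> ` P. x) \<phi> \<in> F P R"
    using f assms inclusion_in_F by (intro compose_closed[of P "\<phi> ` P"]) auto
  moreover have "compose P (\<lambda>x\<in>\<phi> ` P. x) \<phi> = \<phi>"
    by (rule extensionalityI[of _ P]) (use F_D(1)[OF assms(1,2,4)] in \<open>auto simp: compose_def PiE_def\<close>)
  ultimately show ?thesis by simp
qed

text \<open>The formula for \<chi> has the shape that a nonzero mark of \<open>[D, \<phi>]\<close>
  yields: conjugation by \<open>g\<close>, then \<phi>, then conjugation by
  \<open>h\<close>.\<close>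

lemma conj_conj_in_F:
  assumes "subgroup P S" "subgroup D S" "\<phi> \<in> F D (carrier S)" "g \<in> carrier S" "h \<in> carrier S"
    and "\<And>q. q \<in> P \<Longrightarrow> g \<otimes>\<^bsub>S\<^esub> q \<otimes>\<^bsub>S\<^esub> inv\<^bsub>S\<^esub> g \<in> D"
    and "\<chi> \<in> extensional P"
    and "\<And>q. q \<in> P \<Longrightarrow> \<chi> q = h \<otimes>\<^bsub>S\<^esub> \<phi> (g \<otimes>\<^bsub>S\<^esub> q \<otimes>\<^bsub>S\<^esub> inv\<^bsub>S\<^esub> g) \<otimes>\<^bsub>S\<^esub> inv\<^bsub>S\<^esub> h"
  shows "\<chi> \<in> F P (carrier S)"
proof -
  have c: "subgroup (carrier S) S" by (rule S.subgroup_self)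
  have 1: "conj_map S g P \<in> F P D" using assms by (intro conj_map_in_F)
  have 2: "compose P \<phi> (conj_map S g P) \<in> F P (carrier S)"
    using compose_closed[OF assms(1,2) c 1 assms(3)] .
  have 3: "conj_map S h (carrier S) \<in> F (carrier S) (carrier S)"
    using assms c by (intro conj_map_in_F) auto
  have "compose P (conj_map S h (carrier S)) (compose P \<phi> (conj_map S g P)) \<in> F P (carrier S)"
    using compose_closed[OF assms(1) c c 2 3] .
  moreover have "compose P (conj_map S h (carrier S)) (compose P \<phi> (conj_map S g P)) = \<chi>"
    using assms(6-8) F_D(1)[OF assms(2) c assms(3)]
    by (intro extensionalityI[of _ P]) (auto simp: compose_def conj_map_def)
  ultimately show ?thesis by simp
qed

end

subsection \<open>Marks of characteristic idempotents\<close>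

text \<open>The representative from which \<open>basis_comb\<close> forms its coset; marks of a
  generated element are read off from it.\<close>

abbreviation transitive_comb ::
  "'g monoid \<Rightarrow> 'h monoid \<Rightarrow> ('g set \<times> ('g \<Rightarrow> 'h) \<Rightarrow>\<^sub>0 rat) \<Rightarrow> ('g, 'h) formal_comb" where
  "transitive_comb G H c \<equiv> (\<Sum>(K, \<phi>)\<in>Poly_Mapping.keys c.
     Poly_Mapping.single (iso_class G H (transitive_biset G H K \<phi>)) (Poly_Mapping.lookup c (K, \<phi>)))"

lemma keys_transitive_comb:
  assumes "\<And>D \<phi>. (D, \<phi>) \<in> Poly_Mapping.keys c \<Longrightarrow> transitive_biset_data G H D \<phi>"
  shows "Poly_Mapping.keys (transitive_comb G H c) \<subseteq> biset_classes G H"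
  using iso_class_in_biset_classes[OF transitive_biset_data.left_free_transitive[OF assms]]
  by (auto dest!: set_mp[OF keys_sum] split: if_splits)

lemma mark_transitive_comb:
  assumes "\<And>D \<phi>. (D, \<phi>) \<in> Poly_Mapping.keys c \<Longrightarrow> transitive_biset_data G H D \<phi>"
    and "\<alpha> \<in> Q \<rightarrow> carrier H" "\<beta> \<in> Q \<rightarrow> carrier G"
  shows "mark Q \<alpha> \<beta> (transitive_comb G H c) = (\<Sum>(D, \<phi>)\<in>Poly_Mapping.keys c.
    Poly_Mapping.lookup c (D, \<phi>) * of_nat (card (biset_fix Q \<alpha> \<beta> (transitive_biset G H D \<phi>))))"
  unfolding lin_ext_sum using assms
  by (intro sum.cong refl)
    (auto simp: class_mark_iso_class[OF transitive_biset_data.left_free_transitive])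

text \<open>A nonzero sum has a nonzero term, so a single generator already relates \<alpha> to
  \<beta> by conjugations.\<close>

lemma mark_transitive_comb_nonzero:
  assumes "\<And>D \<phi>. (D, \<phi>) \<in> Poly_Mapping.keys c \<Longrightarrow> transitive_biset_data G H D \<phi>"
    and "finite Q" "\<alpha> \<in> Q \<rightarrow> carrier H" "\<beta> \<in> Q \<rightarrow> carrier G"
    and "mark Q \<alpha> \<beta> (transitive_comb G H c) \<noteq> 0"
  shows "\<exists>(D, \<phi>)\<in>Poly_Mapping.keys c. \<exists>h\<in>carrier H. \<exists>g\<in>carrier G.
    \<forall>q\<in>Q. g \<otimes>\<^bsub>G\<^esub> \<beta> q \<otimes>\<^bsub>G\<^esub> inv\<^bsub>G\<^esub> g \<in> D \<and>
      \<alpha> q = h \<otimes>\<^bsub>H\<^esub> \<phi> (g \<otimes>\<^bsub>G\<^esub> \<beta> q \<otimes>\<^bsub>G\<^esub> inv\<^bsub>G\<^esub> g) \<otimes>\<^bsub>H\<^esub> inv\<^bsub>H\<^esub> h"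
proof -
  have "mark Q \<alpha> \<beta> (transitive_comb G H c) = (\<Sum>(D, \<phi>)\<in>Poly_Mapping.keys c.
      Poly_Mapping.lookup c (D, \<phi>) * of_nat (card (biset_fix Q \<alpha> \<beta> (transitive_biset G H D \<phi>))))"
    by (rule mark_transitive_comb[OF assms(1,3,4)])
  from assms(5)[unfolded this] obtain i where i: "i \<in> Poly_Mapping.keys c" "(case i of (D, \<phi>) \<Rightarrow> Poly_Mapping.lookup c (D, \<phi>) *
      of_nat (card (biset_fix Q \<alpha> \<beta> (transitive_biset G H D \<phi>)))) \<noteq> (0 :: rat)"
    by (rule sum.not_neutral_contains_not_neutral)
  obtain D \<phi> where "i = (D, \<phi>)" by (cases i)
  with i have D: "(D, \<phi>) \<in> Poly_Mapping.keys c"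
    "Poly_Mapping.lookup c (D, \<phi>) * of_nat (card (biset_fix Q \<alpha> \<beta> (transitive_biset G H D \<phi>))) \<noteq> 0"
    by simp_all
  then have "card (biset_fix Q \<alpha> \<beta> (transitive_biset G H D \<phi>)) \<noteq> 0" by simp
  then show ?thesis
    using transitive_biset_data.biset_fix_transitive_nonempty[OF assms(1)[OF D(1)] assms(2-4)] D(1)
    by blast
qed

section \<open>The \<open>p\<close>-local integers and the augmentation\<close>

lemma localized_ints_add:
  assumes "prime p" "x \<in> localized_ints p" "y \<in> localized_ints p"
  shows "x + y \<in> localized_ints p"
proof -
  obtain a b where x: "x = of_int a / of_int b" "\<not> int p dvd b"
    using assms(2) unfolding localized_ints_def by auto
  obtain a' b' where y: "y = of_int a' / of_int b'" "\<not> int p dvd b'"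
    using assms(3) unfolding localized_ints_def by auto
  have "b \<noteq> 0" "b' \<noteq> 0" using x y by auto
  then have "x + y = of_int (a * b' + a' * b) / of_int (b * b')"
    unfolding x y by (simp add: field_simps)
  moreover have "\<not> int p dvd b * b'" using x y assms(1) by (simp add: prime_dvd_mult_iff)
  ultimately show ?thesis unfolding localized_ints_def by blast
qed

lemma localized_ints_mult_nat:
  assumes "x \<in> localized_ints p"
  shows "x * of_nat k \<in> localized_ints p"
proof -
  obtain a b where x: "x = of_int a / of_int b" "\<not> int p dvd b"
    using assms unfolding localized_ints_def by auto
  then have "x * of_nat k = of_int (a * int k) / of_int b" by simp
  then show ?thesis unfolding localized_ints_def using x(2) by blast
qed

lemma localized_ints_sum:
  assumes "prime p" "\<And>i. i \<in> I \<Longrightarrow> f i \<in> localized_ints p"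
  shows "sum f I \<in> localized_ints p"
proof -
  have "(0 :: rat) = of_int 0 / of_int 1" "\<not> int p dvd 1"
    using assms(1) not_prime_unit by (auto simp: prime_nat_iff)
  then have "(0 :: rat) \<in> localized_ints p" unfolding localized_ints_def by blast
  then show ?thesis
    using assms by (induction I rule: infinite_finite_induct) (auto intro: localized_ints_add)
qed

text \<open>The definite description demands a value independent of the chosen combination. For the
  empty index set the mark counts all points, and \<open>[P, \<phi>]\<close> has
  \<open>|S| |S/P|\<close> of them. So the order of \<open>S\<close> times the sum is a mark, hence
  an invariant of the coset.\<close>

lemma augmentation_basis_comb:
  fixes S :: "'a monoid"
  assumes "group S" "finite (carrier S)"
    and c: "\<forall>(P, \<phi>)\<in>Poly_Mapping.keys c. subgroup P S \<and> \<phi> \<in> hom (S\<lparr>carrier := P\<rparr>) S"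
    and loc: "\<forall>i. Poly_Mapping.lookup c i \<in> localized_ints p"
  shows "augmentation p S (basis_comb p S S c) = (\<Sum>(P, \<phi>)\<in>Poly_Mapping.keys c.
    Poly_Mapping.lookup c (P, \<phi>) * of_nat (card (rcosets\<^bsub>S\<^esub> P)))"
proof -
  interpret group S by fact
  let ?r = "\<lambda>c. \<Sum>(P, \<phi>)\<in>Poly_Mapping.keys c.
    Poly_Mapping.lookup c (P, \<phi>) * of_nat (card (rcosets\<^bsub>S\<^esub> P)) :: rat"
  let ?id = "\<lambda>x::'a. x"
  have card: "mark {} ?id ?id (transitive_comb S S c) = of_nat (card (carrier S)) * ?r c"
    if c: "\<forall>(P, \<phi>)\<in>Poly_Mapping.keys c. subgroup P S \<and> \<phi> \<in> hom (S\<lparr>carrier := P\<rparr>) S" for c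
  proof -
    have data: "transitive_biset_data S S D \<phi>" if "(D, \<phi>) \<in> Poly_Mapping.keys c" for D \<phi>
      using that c assms by (auto intro!: transitive_biset_data.intro)
    have "card (biset_fix {} ?id ?id (transitive_biset S S D \<phi>)) = card (carrier S) * card (rcosets\<^bsub>S\<^esub> D)"
      if D: "(D, \<phi>) \<in> Poly_Mapping.keys c" for D \<phi>
    proof -
      have sub: "subgroup D S" using c D by auto
      have "card D * card (biset_fix {} ?id ?id (transitive_biset S S D \<phi>)) = card (carrier S) * card (carrier S)"
        using transitive_biset_data.card_biset_fix_transitive[OF data[OF D], of "{}" ?id ?id] by simp
      also have "\<dots> = card D * (card (carrier S) * card (rcosets\<^bsub>S\<^esub> D))"
        using lagrange[OF sub] by (simp add: order_def mult_ac)
      finally have "card D * card (biset_fix {} ?id ?id (transitive_biset S S D \<phi>)) =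
        card D * (card (carrier S) * card (rcosets\<^bsub>S\<^esub> D))" .
      moreover have "card D \<noteq> 0"
        using finite_subset[OF subgroup.subset[OF sub] assms(2)] subgroup.one_closed[OF sub] by auto
      ultimately show ?thesis by simp
    qed
    then show ?thesis
      using mark_transitive_comb[of c S S ?id "{}" ?id] data
      by (auto simp: sum_distrib_left mult_ac intro!: sum.cong)
  qed
  show ?thesis
    unfolding augmentation_def
  proof (rule the_equality)
    fix r
    assume "\<exists>c'. (\<forall>(P, \<phi>)\<in>Poly_Mapping.keys c'. subgroup P S \<and> \<phi> \<in> hom (S\<lparr>carrier := P\<rparr>) S) \<and>
       (\<forall>i. Poly_Mapping.lookup c' i \<in> localized_ints p) \<and>
       basis_comb p S S c = basis_comb p S S c' \<and> r = ?r c'"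
    then obtain c' where c': "\<forall>(P, \<phi>)\<in>Poly_Mapping.keys c'. subgroup P S \<and> \<phi> \<in> hom (S\<lparr>carrier := P\<rparr>) S"
       "basis_comb p S S c = basis_comb p S S c'" "r = ?r c'" by blast
    have "transitive_comb S S c \<in> burnside_coset p S S (transitive_comb S S c')"
      using c'(2) burnside_coset_self unfolding basis_comb_def by blast
    then have "mark {} ?id ?id (transitive_comb S S c) = mark {} ?id ?id (transitive_comb S S c')"
      by (rule mark_burnside_coset) auto
    then have "of_nat (card (carrier S)) * ?r c = of_nat (card (carrier S)) * ?r c'"
      using card[OF c] card[OF c'(1)] by simp
    moreover have "(of_nat (card (carrier S)) :: rat) \<noteq> 0" using assms(2) one_closed by auto
    ultimately show "r = ?r c" using c'(3) by simp
  qed (use c loc in blast)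
qed

section \<open>Marks of stable elements\<close>

context fusion
begin

lemma transitive_data:
  assumes "finite (carrier S)" "subgroup D S" "\<phi> \<in> F D (carrier S)"
  shows "transitive_biset_data S S D \<phi>"
  using assms F_D(3)[OF assms(2) S.subgroup_self assms(3)] grp by (intro transitive_biset_data.intro)

text \<open>
  A fixed point represented by \<open>(h, g)\<close> determines \<open>\<chi>\<close> as a composite of conjugations with \<open>\<phi>\<^sup>-\<^sup>1\<close>,
  so the sum counts all pairs for which such a composite is defined.
\<close>

lemma sum_card_fix_transitive:
  assumes fin: "finite (carrier S)" and D: "subgroup D S" "\<phi> \<in> F D (carrier S)" and Q: "subgroup Q S"
  shows "card D * (\<Sum>\<chi>\<in>F Q (carrier S). card (biset_fix Q (\<lambda>x. x) \<chi> (transitive_biset S S D \<phi>))) =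
    card (carrier S) * card {h \<in> carrier S. \<forall>q\<in>Q. h \<otimes>\<^bsub>S\<^esub> q \<otimes>\<^bsub>S\<^esub> inv\<^bsub>S\<^esub> h \<in> \<phi> ` D}"
proof -
  interpret T: transitive_biset_data S S D \<phi> by (rule transitive_data[OF fin D])
  note fac = morphism_factorization[OF D(1) S.subgroup_self D(2)]
  note phi = F_D[OF D(1) S.subgroup_self D(2)]
  have Qc: "q \<in> carrier S" if "q \<in> Q" for q using that Q subgroup.mem_carrier by fast
  have Dc: "q \<in> carrier S" if "q \<in> D" for q using that D(1) subgroup.mem_carrier by fast
  have phic: "\<phi> k \<in> carrier S" if "k \<in> D" for k using phi(1) that by auto
  have finQ: "finite Q" and finD: "finite D"
    using fin Qc Dc by (meson finite_subset subsetI)+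
  have chi: "\<chi> \<in> Q \<rightarrow>\<^sub>E carrier S" if "\<chi> \<in> F Q (carrier S)" for \<chi>
    using F_D(1)[OF Q S.subgroup_self that] .
  have finF: "finite (F Q (carrier S))"
    by (rule finite_subset[of _ "Q \<rightarrow>\<^sub>E carrier S"]) (use chi finQ fin in \<open>auto intro: finite_PiE\<close>)
  let ?A = "\<lambda>\<gamma>. {h \<in> carrier S. \<forall>q\<in>Q. q \<otimes>\<^bsub>S\<^esub> h = h \<otimes>\<^bsub>S\<^esub> \<phi> (\<gamma> q)}"
  let ?B = "\<lambda>\<gamma> \<chi>. {g \<in> carrier S. \<forall>q\<in>Q. \<gamma> q \<otimes>\<^bsub>S\<^esub> g = g \<otimes>\<^bsub>S\<^esub> \<chi> q}"
  let ?C = "{h \<in> carrier S. \<forall>q\<in>Q. \<exists>k\<in>D. q \<otimes>\<^bsub>S\<^esub> h = h \<otimes>\<^bsub>S\<^esub> \<phi> k}"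
  let ?C' = "{h \<in> carrier S. \<forall>q\<in>Q. h \<otimes>\<^bsub>S\<^esub> q \<otimes>\<^bsub>S\<^esub> inv\<^bsub>S\<^esub> h \<in> \<phi> ` D}"
  \<comment> \<open>A witness \<open>h\<close> in \<open>?A \<gamma>\<close> shows that \<gamma> is
    conjugation by \<open>inv h\<close> followed by the inverse of \<phi>. So for every
    \<open>g\<close> the conjugate of \<gamma> by \<open>inv g\<close> is a morphism of
    \<open>F\<close>, and it is the only \<chi> that \<open>g\<close> intertwines with
    \<gamma>.\<close>
  have B: "(\<Sum>\<chi>\<in>F Q (carrier S). card (?B \<gamma> \<chi>)) = card (carrier S)"
    if gam: "\<gamma> \<in> Q \<rightarrow>\<^sub>E D" "?A \<gamma> \<noteq> {}" for \<gamma>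
  proof (rule sum_card_eq_card[OF finF fin])
    fix g assume g: "g \<in> carrier S"
    from gam(2) obtain h where h: "h \<in> carrier S" "\<And>q. q \<in> Q \<Longrightarrow> q \<otimes>\<^bsub>S\<^esub> h = h \<otimes>\<^bsub>S\<^esub> \<phi> (\<gamma> q)" by blast
    let ?\<chi> = "\<lambda>q\<in>Q. inv\<^bsub>S\<^esub> g \<otimes>\<^bsub>S\<^esub> \<gamma> q \<otimes>\<^bsub>S\<^esub> g"
    have gm: "\<gamma> q \<in> D" if "q \<in> Q" for q using gam that by auto
    have hq: "inv\<^bsub>S\<^esub> h \<otimes>\<^bsub>S\<^esub> q \<otimes>\<^bsub>S\<^esub> inv\<^bsub>S\<^esub> (inv\<^bsub>S\<^esub> h) = \<phi> (\<gamma> q)" if q: "q \<in> Q" for q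
    proof -
      have "inv\<^bsub>S\<^esub> h \<otimes>\<^bsub>S\<^esub> (q \<otimes>\<^bsub>S\<^esub> h) = \<phi> (\<gamma> q)"
        unfolding h(2)[OF q] using h(1) phic[OF gm[OF q]] by (simp add: S.m_assoc[symmetric])
      then show ?thesis using h(1) Qc[OF q] by (simp add: S.m_assoc)
    qed
    have "?\<chi> \<in> F Q (carrier S)"
    proof (rule conj_conj_in_F[OF Q fac(1), where g = "inv\<^bsub>S\<^esub> h" and h = "inv\<^bsub>S\<^esub> g"])
      show "(\<lambda>y\<in>\<phi> ` D. inv_into D \<phi> y) \<in> F (\<phi> ` D) (carrier S)"
        by (rule change_codomain[OF fac(1) D(1) S.subgroup_self fac(3)])
          (use Dc in \<open>auto simp: inv_into_into\<close>)
    qed (use g h(1) hq gm phi(2) in auto)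
    moreover have "\<forall>q\<in>Q. \<gamma> q \<otimes>\<^bsub>S\<^esub> g = g \<otimes>\<^bsub>S\<^esub> ?\<chi> q"
      using g gm Dc by (simp add: S.m_assoc[symmetric])
    moreover have "\<chi> = ?\<chi>" if x: "\<chi> \<in> F Q (carrier S)" "\<forall>q\<in>Q. \<gamma> q \<otimes>\<^bsub>S\<^esub> g = g \<otimes>\<^bsub>S\<^esub> \<chi> q" for \<chi>
    proof (rule extensionalityI[of _ Q])
      fix q assume q: "q \<in> Q"
      have "inv\<^bsub>S\<^esub> g \<otimes>\<^bsub>S\<^esub> \<gamma> q \<otimes>\<^bsub>S\<^esub> g = inv\<^bsub>S\<^esub> g \<otimes>\<^bsub>S\<^esub> (g \<otimes>\<^bsub>S\<^esub> \<chi> q)"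
        using x(2) q g Dc[OF gm[OF q]] by (simp add: S.m_assoc)
      also have "\<dots> = \<chi> q" using g PiE_mem[OF chi[OF x(1)] q] by (simp add: S.m_assoc[symmetric])
      finally show "\<chi> q = ?\<chi> q" using q by simp
    qed (use chi[OF x(1)] in \<open>auto simp: PiE_def\<close>)
    ultimately show "\<exists>!\<chi>. \<chi> \<in> F Q (carrier S) \<and> (\<forall>q\<in>Q. \<gamma> q \<otimes>\<^bsub>S\<^esub> g = g \<otimes>\<^bsub>S\<^esub> \<chi> q)" by blast
  qed
  \<comment> \<open>As \<phi> is injective, \<open>h\<close> determines \<gamma>. Summing over
    \<gamma> therefore counts each admissible \<open>h\<close> once.\<close>
  have A: "(\<Sum>\<gamma>\<in>Q \<rightarrow>\<^sub>E D. card (?A \<gamma>)) = card ?C"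
  proof -
    have "(\<Sum>\<gamma>\<in>Q \<rightarrow>\<^sub>E D. card {h \<in> ?C. \<forall>q\<in>Q. q \<otimes>\<^bsub>S\<^esub> h = h \<otimes>\<^bsub>S\<^esub> \<phi> (\<gamma> q)}) = card ?C"
    proof (rule sum_card_eq_card)
      show "finite (Q \<rightarrow>\<^sub>E D)" using finQ finD by (intro finite_PiE) auto
      fix h assume h: "h \<in> ?C"
      then have "\<forall>q\<in>Q. \<exists>k. k \<in> D \<and> q \<otimes>\<^bsub>S\<^esub> h = h \<otimes>\<^bsub>S\<^esub> \<phi> k" by blast
      from bchoice[OF this] obtain \<gamma>
        where g: "\<forall>q\<in>Q. \<gamma> q \<in> D \<and> q \<otimes>\<^bsub>S\<^esub> h = h \<otimes>\<^bsub>S\<^esub> \<phi> (\<gamma> q)" by blast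
      show "\<exists>!\<gamma>. \<gamma> \<in> Q \<rightarrow>\<^sub>E D \<and> (\<forall>q\<in>Q. q \<otimes>\<^bsub>S\<^esub> h = h \<otimes>\<^bsub>S\<^esub> \<phi> (\<gamma> q))"
      proof (rule ex1I[of _ "restrict \<gamma> Q"])
        fix \<gamma>' assume g': "\<gamma>' \<in> Q \<rightarrow>\<^sub>E D \<and> (\<forall>q\<in>Q. q \<otimes>\<^bsub>S\<^esub> h = h \<otimes>\<^bsub>S\<^esub> \<phi> (\<gamma>' q))"
        show "\<gamma>' = restrict \<gamma> Q"
        proof (rule extensionalityI[of _ Q])
          fix q assume q: "q \<in> Q"
          have "h \<otimes>\<^bsub>S\<^esub> \<phi> (\<gamma>' q) = h \<otimes>\<^bsub>S\<^esub> \<phi> (\<gamma> q)" using g g' q by metis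
          moreover have m: "\<gamma>' q \<in> D" "\<gamma> q \<in> D" using g g' q by auto
          ultimately have "\<phi> (\<gamma>' q) = \<phi> (\<gamma> q)" using h phic by simp
          then show "\<gamma>' q = restrict \<gamma> Q q" using m q phi(2) by (simp add: inj_on_eq_iff)
        qed (use g' in \<open>auto simp: PiE_def\<close>)
      qed (use g in auto)
    qed (use fin in simp)
    moreover have "{h \<in> ?C. \<forall>q\<in>Q. q \<otimes>\<^bsub>S\<^esub> h = h \<otimes>\<^bsub>S\<^esub> \<phi> (\<gamma> q)} = ?A \<gamma>" if "\<gamma> \<in> Q \<rightarrow>\<^sub>E D" for \<gamma>
      using that by blast
    ultimately show ?thesis by (simp cong: sum.cong)
  qed
  \<comment> \<open>Inversion of \<open>h\<close> brings the condition into the form of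
    \<open>card_subconjugators\<close>.\<close>
  have C: "card ?C = card ?C'"
  proof (rule bij_betw_same_card)
    have iff: "h \<in> ?C \<longleftrightarrow> inv\<^bsub>S\<^esub> h \<in> ?C'" if h: "h \<in> carrier S" for h
    proof -
      have "q \<otimes>\<^bsub>S\<^esub> h = h \<otimes>\<^bsub>S\<^esub> \<phi> k \<longleftrightarrow> inv\<^bsub>S\<^esub> h \<otimes>\<^bsub>S\<^esub> q \<otimes>\<^bsub>S\<^esub> h = \<phi> k" if "q \<in> Q" "k \<in> D" for q k
        using h Qc[OF that(1)] phic[OF that(2)]
        by (simp add: S.m_assoc S.inv_solve_left' eq_commute[of "h \<otimes>\<^bsub>S\<^esub> \<phi> k"])
      then have "(\<exists>k\<in>D. q \<otimes>\<^bsub>S\<^esub> h = h \<otimes>\<^bsub>S\<^esub> \<phi> k) \<longleftrightarrow> inv\<^bsub>S\<^esub> h \<otimes>\<^bsub>S\<^esub> q \<otimes>\<^bsub>S\<^esub> h \<in> \<phi> ` D" if "q \<in> Q" for q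
        using that by (simp add: image_iff cong: bex_cong)
      then show ?thesis using h by (simp cong: ball_cong)
    qed
    show "bij_betw (\<lambda>h. inv\<^bsub>S\<^esub> h) ?C ?C'"
    proof (rule bij_betw_byWitness[where f' = "\<lambda>h. inv\<^bsub>S\<^esub> h"])
      show "(\<lambda>h. inv\<^bsub>S\<^esub> h) ` ?C \<subseteq> ?C'"
        using iff by blast
      show "(\<lambda>h. inv\<^bsub>S\<^esub> h) ` ?C' \<subseteq> ?C"
      proof (rule image_subsetI)
        fix h assume "h \<in> ?C'"
        then show "inv\<^bsub>S\<^esub> h \<in> ?C" using iff[of "inv\<^bsub>S\<^esub> h"] by simp
      qed
    qed auto
  qed
  have "card D * (\<Sum>\<chi>\<in>F Q (carrier S). card (biset_fix Q (\<lambda>x. x) \<chi> (transitive_biset S S D \<phi>))) =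
      (\<Sum>\<chi>\<in>F Q (carrier S). \<Sum>\<gamma>\<in>Q \<rightarrow>\<^sub>E D. card (?A \<gamma>) * card (?B \<gamma> \<chi>))"
    unfolding sum_distrib_left
  proof (rule sum.cong[OF refl])
    fix \<chi> assume "\<chi> \<in> F Q (carrier S)"
    then have "\<chi> \<in> Q \<rightarrow> carrier S" using chi by (auto simp: PiE_def)
    then show "card D * card (biset_fix Q (\<lambda>x. x) \<chi> (transitive_biset S S D \<phi>)) =
        (\<Sum>\<gamma>\<in>Q \<rightarrow>\<^sub>E D. card (?A \<gamma>) * card (?B \<gamma> \<chi>))"
      using T.card_biset_fix_transitive[OF finQ, of "\<lambda>x. x" \<chi>] Qc by auto
  qed
  also have "\<dots> = (\<Sum>\<gamma>\<in>Q \<rightarrow>\<^sub>E D. card (?A \<gamma>) * (\<Sum>\<chi>\<in>F Q (carrier S). card (?B \<gamma> \<chi>)))"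
    unfolding sum_distrib_left by (rule sum.swap)
  also have "\<dots> = (\<Sum>\<gamma>\<in>Q \<rightarrow>\<^sub>E D. card (?A \<gamma>) * card (carrier S))"
  proof (rule sum.cong[OF refl])
    fix \<gamma> assume \<gamma>: "\<gamma> \<in> Q \<rightarrow>\<^sub>E D"
    show "card (?A \<gamma>) * (\<Sum>\<chi>\<in>F Q (carrier S). card (?B \<gamma> \<chi>)) = card (?A \<gamma>) * card (carrier S)"
    proof (cases "?A \<gamma> = {}")
      case True
      show ?thesis unfolding True by simp
    next
      case False
      show ?thesis unfolding B[OF \<gamma> False] ..
    qed
  qed
  also have "\<dots> = card (carrier S) * card ?C'"
    unfolding sum_distrib_right[symmetric] A C by (rule mult.commute)
  finally show ?thesis .
qed

text \<open>Marks are taken on both sides of the stability identity. By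
  \<open>mark_comp_hom\<close>, composing with \<open>[P, \<phi>]\<close> inserts \<phi> after
  \<beta>, while composing with the inclusion leaves \<beta> as it is.\<close>

lemma mark_right_stable:
  assumes fin: "finite (carrier S)" and stable: "right_stable p S F S (burnside_coset p S S x)"
    and x: "Poly_Mapping.keys x \<subseteq> biset_classes S S"
    and P: "subgroup P S" "\<phi> \<in> F P (carrier S)"
    and Q: "finite Q" "\<alpha> \<in> Q \<rightarrow> carrier S" "\<beta> \<in> Q \<rightarrow> P"
  shows "mark Q \<alpha> (\<lambda>q. \<phi> (\<beta> q)) x = mark Q \<alpha> \<beta> x"
proof -
  let ?P = "S\<lparr>carrier := P\<rparr>"
  have data: "transitive_biset_data ?P S (carrier ?P) \<psi>" if "\<psi> \<in> F P (carrier S)" for \<psi>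
    using that F_D(3)[OF P(1) S.subgroup_self that] grp fin P(1) S.subgroup_imp_group[OF P(1)]
      finite_subset[OF subgroup.subset[OF P(1)] fin]
    by (intro transitive_biset_data.intro) (auto intro: group.subgroup_self[of ?P, simplified])
  have incl: "(\<lambda>x\<in>P. x) \<in> F P (carrier S)"
    using P(1) S.subgroup_self subgroup.subset by (intro inclusion_in_F) auto
  have b: "\<beta> \<in> Q \<rightarrow> carrier ?P" using Q(3) by simp
  let ?y = "Poly_Mapping.single (iso_class ?P S (transitive_biset ?P S P \<phi>)) 1"
  let ?u = "formal_comp ?P S S x ?y"
  have y: "?y \<in> basis_elem p ?P S P \<phi>" unfolding basis_elem_def by (rule burnside_coset_self)
  \<comment> \<open>The stability identity is an equality of sets of combinations. A member of one
    side is transferred to the other, where it comes with representatives of its own.\<close>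
  have "?u \<in> burnside_comp p ?P S S (burnside_coset p S S x) (basis_elem p ?P S P \<phi>)"
    unfolding burnside_comp_def using burnside_coset_self y by blast
  then have "?u \<in> burnside_comp p ?P S S (burnside_coset p S S x) (basis_elem p ?P S P (\<lambda>x\<in>P. x))"
    using stable P unfolding right_stable_def by blast
  then obtain x' y' where xy: "x' \<in> burnside_coset p S S x" "y' \<in> basis_elem p ?P S P (\<lambda>x\<in>P. x)"
    "?u \<in> burnside_coset p ?P S (formal_comp ?P S S x' y')"
    unfolding burnside_comp_def by blast
  have x': "Poly_Mapping.keys x' \<subseteq> biset_classes S S" using keys_burnside_coset[OF xy(1) x] .
  have "mark Q \<alpha> (\<lambda>q. \<phi> (\<beta> q)) x = mark Q \<alpha> \<beta> ?u"
    using mark_comp_hom[OF data[OF P(2)] grp Q(1) x Q(2) b, of ?y p ?u] y burnside_coset_self[of ?u p ?P S] by simp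
  also have "\<dots> = mark Q \<alpha> (\<lambda>q. (\<lambda>x\<in>P. x) (\<beta> q)) x'"
    using mark_comp_hom[OF data[OF incl] grp Q(1) x' Q(2) b, of y' p ?u] xy by simp
  also have "\<dots> = mark Q \<alpha> \<beta> x'"
    using class_mark_cong[of Q \<alpha> \<alpha> "\<lambda>q. (\<lambda>x\<in>P. x) (\<beta> q)" \<beta>] Q(3) by (auto simp: Pi_iff)
  also have "\<dots> = mark Q \<alpha> \<beta> x"
    using mark_burnside_coset[OF xy(1) Q(2)] Q(3) subgroup.mem_carrier[OF P(1)] by auto
  finally show ?thesis .
qed

text \<open>If the mark vanished, stability would make the marks for all \<chi> in
  \<open>F Q (carrier S)\<close> vanish as well. Expanding their sum in the generators would then
  place the augmentation in \<open>p\<close> times the \<open>p\<close>-local integers.\<close>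

lemma mark_identity_nonzero:
  assumes p: "prime p" "order S = p ^ n" and fin: "finite (carrier S)"
    and c: "\<forall>(P, \<phi>)\<in>Poly_Mapping.keys c. subgroup P S \<and> \<phi> \<in> F P (carrier S)"
    and loc: "\<forall>i. Poly_Mapping.lookup c i \<in> localized_ints p"
    and stable: "right_stable p S F S (basis_comb p S S c)"
    and aug: "\<not> (\<exists>s\<in>localized_ints p. augmentation p S (basis_comb p S S c) = of_nat p * s)"
    and Q: "subgroup Q S"
  shows "mark Q (\<lambda>x. x) (\<lambda>x. x) (transitive_comb S S c) \<noteq> 0"
proof
  assume zero: "mark Q (\<lambda>x. x) (\<lambda>x. x) (transitive_comb S S c) = 0"
  let ?keys = "Poly_Mapping.keys c" and ?c = "Poly_Mapping.lookup c"
  let ?C = "\<lambda>D \<phi>. {h \<in> carrier S. \<forall>q\<in>Q. h \<otimes>\<^bsub>S\<^esub> q \<otimes>\<^bsub>S\<^esub> inv\<^bsub>S\<^esub> h \<in> \<phi> ` D}"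
  let ?X = "\<lambda>(D, \<phi>). transitive_biset S S D \<phi>"
  have data: "transitive_biset_data S S D \<phi>" if "(D, \<phi>) \<in> ?keys" for D \<phi>
    using transitive_data[OF fin] that c by auto
  have Qc: "q \<in> carrier S" if "q \<in> Q" for q using that Q subgroup.mem_carrier by fast
  have finQ: "finite Q" using Qc fin by (meson finite_subset subsetI)
  have "mark Q (\<lambda>x. x) \<chi> (transitive_comb S S c) = 0" if "\<chi> \<in> F Q (carrier S)" for \<chi>
    using mark_right_stable[OF fin stable[unfolded basis_comb_def] keys_transitive_comb[OF data]
        Q that finQ, of "\<lambda>x. x" "\<lambda>x. x"] zero Qc by auto
  moreover have "mark Q (\<lambda>x. x) \<chi> (transitive_comb S S c) =
      (\<Sum>i\<in>?keys. ?c i * of_nat (card (biset_fix Q (\<lambda>x. x) \<chi> (?X i))))" if "\<chi> \<in> F Q (carrier S)" for \<chi>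
    using mark_transitive_comb[of c S S "\<lambda>x. x" Q \<chi>, OF data] F_D(1)[OF Q S.subgroup_self that] Qc
    by (auto simp: case_prod_unfold PiE_def)
  ultimately have "0 = (\<Sum>\<chi>\<in>F Q (carrier S). \<Sum>i\<in>?keys. ?c i * of_nat (card (biset_fix Q (\<lambda>x. x) \<chi> (?X i))))"
    by simp
  also have "\<dots> = (\<Sum>i\<in>?keys. \<Sum>\<chi>\<in>F Q (carrier S). ?c i * of_nat (card (biset_fix Q (\<lambda>x. x) \<chi> (?X i))))"
    by (rule sum.swap)
  also have "\<dots> = (\<Sum>i\<in>?keys. ?c i * of_nat (\<Sum>\<chi>\<in>F Q (carrier S). card (biset_fix Q (\<lambda>x. x) \<chi> (?X i))))"
    by (simp add: sum_distrib_left)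
  finally have sum0: "(\<Sum>i\<in>?keys. ?c i * of_nat (\<Sum>\<chi>\<in>F Q (carrier S). card (biset_fix Q (\<lambda>x. x) \<chi> (?X i)))) = 0"
    by simp
  have "\<exists>m k. (\<Sum>\<chi>\<in>F Q (carrier S). card (biset_fix Q (\<lambda>x. x) \<chi> (?X i))) = card (carrier S) * m \<and>
      card (rcosets\<^bsub>S\<^esub> (fst i)) = m + p * k" if "i \<in> ?keys" for i
  proof -
    obtain D \<phi> where i: "i = (D, \<phi>)" by (cases i)
    have D: "subgroup D S" "\<phi> \<in> F D (carrier S)" using c that i by auto
    have E: "subgroup (\<phi> ` D) S" using morphism_factorization(1)[OF D(1) S.subgroup_self D(2)] .
    have cardE: "card (\<phi> ` D) = card D" using F_D(2)[OF D(1) S.subgroup_self D(2)] by (rule card_image)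
    have pos: "card D \<noteq> 0"
      using finite_subset[OF subgroup.subset[OF D(1)] fin] subgroup.one_closed[OF D(1)] by auto
    have "card (rcosets\<^bsub>S\<^esub> D) * card D = card (rcosets\<^bsub>S\<^esub> (\<phi> ` D)) * card D"
      using S.lagrange[OF D(1)] S.lagrange[OF E] cardE by simp
    then have idx: "card (rcosets\<^bsub>S\<^esub> D) = card (rcosets\<^bsub>S\<^esub> (\<phi> ` D))" using pos by simp
    obtain m k where mk: "card (?C D \<phi>) = card (\<phi> ` D) * m" "card (rcosets\<^bsub>S\<^esub> (\<phi> ` D)) = m + p * k"
      using S.card_subconjugators[OF p fin E Q] by blast
    have "card D * (\<Sum>\<chi>\<in>F Q (carrier S). card (biset_fix Q (\<lambda>x. x) \<chi> (?X i))) =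
        card D * (card (carrier S) * m)"
      using sum_card_fix_transitive[OF fin D Q] mk(1) cardE i by (simp add: mult_ac)
    then show ?thesis using pos mk(2) idx i by auto
  qed
  then obtain m k where mk: "\<forall>i\<in>?keys.
      (\<Sum>\<chi>\<in>F Q (carrier S). card (biset_fix Q (\<lambda>x. x) \<chi> (?X i))) = card (carrier S) * m i \<and>
      card (rcosets\<^bsub>S\<^esub> (fst i)) = m i + p * k i"
    by metis
  have "of_nat (card (carrier S)) * (\<Sum>i\<in>?keys. ?c i * of_nat (m i)) = 0"
    using sum0 mk by (simp add: sum_distrib_left mult_ac)
  moreover have "(of_nat (card (carrier S)) :: rat) \<noteq> 0" using fin S.one_closed by auto
  ultimately have m0: "(\<Sum>i\<in>?keys. ?c i * of_nat (m i)) = 0" by simp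
  have c': "\<forall>(P, \<phi>)\<in>?keys. subgroup P S \<and> \<phi> \<in> hom (S\<lparr>carrier := P\<rparr>) S"
    using c F_D(3)[OF _ S.subgroup_self] by auto
  \<comment> \<open>Splitting each index as \<open>m i + p * k i\<close>, the first part sums to
    zero by \<open>m0\<close>.\<close>
  have "augmentation p S (basis_comb p S S c) = (\<Sum>i\<in>?keys. ?c i * of_nat (card (rcosets\<^bsub>S\<^esub> (fst i))))"
    unfolding augmentation_basis_comb[OF grp fin c' loc] by (simp add: case_prod_unfold)
  also have "\<dots> = (\<Sum>i\<in>?keys. ?c i * of_nat (m i)) + of_nat p * (\<Sum>i\<in>?keys. ?c i * of_nat (k i))"
    using mk by (simp add: sum_distrib_left sum.distrib algebra_simps)
  also have "\<dots> = of_nat p * (\<Sum>i\<in>?keys. ?c i * of_nat (k i))" using m0 by simp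
  finally have "augmentation p S (basis_comb p S S c) = of_nat p * (\<Sum>i\<in>?keys. ?c i * of_nat (k i))" .
  moreover have "(\<Sum>i\<in>?keys. ?c i * of_nat (k i)) \<in> localized_ints p"
    using loc by (intro localized_ints_sum[OF p(1)] localized_ints_mult_nat) auto
  ultimately show False using aug by blast
qed

end

text \<open>Moves the pair of inclusions of the image of \<phi> to the pair
  \<open>(\<phi>, \<phi>)\<close> on the source, the form to which right stability applies.\<close>

lemma class_mark_image: "class_mark (f ` Q) \<alpha> \<beta> = class_mark Q (\<lambda>q. \<alpha> (f q)) (\<lambda>q. \<beta> (f q))"
  by (auto simp: class_mark_def biset_fix_def fun_eq_iff)

section \<open>Factorization of the morphisms of \<open>F\<close>\<close>

theorem mainTheorem2:
  fixes p :: nat and S :: "'a monoid" and T :: "'a set"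
    and F H K :: "'a hom_sets"
    and \<omega>\<^sub>F \<omega>\<^sub>H \<omega>\<^sub>K :: "('a, 'a) burnside_elem"
  assumes "prime p" and "finite_p_group p S"
    and "saturated_fusion_system p S F"
    and "fusion_subsystem S F (carrier S) H"
    and "saturated_fusion_system p S H"
    and "subgroup T S"
    and "fusion_subsystem S F T K"
    and "saturated_fusion_system p (S\<lparr>carrier := T\<rparr>) K"
    and "characteristic_idempotent p S F \<omega>\<^sub>F"
    and "characteristic_idempotent p S H \<omega>\<^sub>H"
    and "characteristic_idempotent p (S\<lparr>carrier := T\<rparr>) K \<omega>\<^sub>K"
    and "burnside_comp p (S\<lparr>carrier := T\<rparr>) S S \<omega>\<^sub>F
           (basis_elem p (S\<lparr>carrier := T\<rparr>) S T (\<lambda>x\<in>T. x)) =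
         burnside_comp p (S\<lparr>carrier := T\<rparr>) (S\<lparr>carrier := T\<rparr>) S
           (burnside_comp p (S\<lparr>carrier := T\<rparr>) S S \<omega>\<^sub>H
             (basis_elem p (S\<lparr>carrier := T\<rparr>) S T (\<lambda>x\<in>T. x)))
           \<omega>\<^sub>K"
  shows "composition_product S F (carrier S) H T K"
proof -
  let ?T = "S\<lparr>carrier := T\<rparr>" and ?i = "\<lambda>x\<in>T. x" and ?id = "\<lambda>x::'a. x"
  obtain n where S: "group S" "finite (carrier S)" "order S = p ^ n"
    using assms(2) unfolding finite_p_group_def by auto
  interpret S: group S by (rule S)
  have grpT: "group ?T" using S.subgroup_imp_group[OF assms(6)] .
  have Tsub: "T \<subseteq> carrier S" using assms(6) by (rule subgroup.subset)
  have finT: "finite (carrier ?T)" using Tsub S(2) finite_subset by auto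
  interpret F: fusion S F
    using S assms(3) by (intro fusion.intro) (simp_all add: saturated_fusion_system_def)
  interpret H: fusion S H
    using S assms(5) by (intro fusion.intro) (simp_all add: saturated_fusion_system_def)
  interpret K: fusion ?T K
    using grpT assms(8) by (intro fusion.intro) (simp_all add: saturated_fusion_system_def)
  obtain cF where cF: "\<forall>(P, \<phi>)\<in>Poly_Mapping.keys cF. subgroup P S \<and> \<phi> \<in> F P (carrier S)"
    "\<forall>i. Poly_Mapping.lookup cF i \<in> localized_ints p" "\<omega>\<^sub>F = basis_comb p S S cF"
    using assms(9) unfolding characteristic_idempotent_def fusion_generated_def by blast
  obtain cH where cH: "\<forall>(P, \<phi>)\<in>Poly_Mapping.keys cH. subgroup P S \<and> \<phi> \<in> H P (carrier S)"
    "\<omega>\<^sub>H = basis_comb p S S cH"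
    using assms(10) unfolding characteristic_idempotent_def fusion_generated_def by blast
  obtain cK where cK: "\<forall>(P, \<phi>)\<in>Poly_Mapping.keys cK. subgroup P ?T \<and> \<phi> \<in> K P (carrier ?T)"
    "\<omega>\<^sub>K = basis_comb p ?T ?T cK"
    using assms(11) unfolding characteristic_idempotent_def fusion_generated_def by blast
  have stable: "right_stable p S F S \<omega>\<^sub>F"
    and aug: "\<not> (\<exists>s\<in>localized_ints p. augmentation p S \<omega>\<^sub>F = of_nat p * s)"
    using assms(9) unfolding characteristic_idempotent_def by blast+
  let ?xF = "transitive_comb S S cF" and ?xH = "transitive_comb S S cH"
    and ?xK = "transitive_comb ?T ?T cK"
  have dF: "transitive_biset_data S S D \<phi>" if "(D, \<phi>) \<in> Poly_Mapping.keys cF" for D \<phi>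
    using that cF(1) F.transitive_data[OF S(2)] by auto
  have dH: "transitive_biset_data S S D \<phi>" if "(D, \<phi>) \<in> Poly_Mapping.keys cH" for D \<phi>
    using that cH(1) H.transitive_data[OF S(2)] by auto
  have dK: "transitive_biset_data ?T ?T D \<phi>" if "(D, \<phi>) \<in> Poly_Mapping.keys cK" for D \<phi>
    using that cK(1) K.transitive_data[OF finT] by auto
  note xF = keys_transitive_comb[OF dF]
  note xH = keys_transitive_comb[OF dH]
  note xK = keys_transitive_comb[OF dK]
  have "?i \<in> hom ?T S" using Tsub assms(6) by (auto simp: hom_def subgroup.m_closed)
  then have dT: "transitive_biset_data ?T S (carrier ?T) ?i"
    using grpT S finT group.subgroup_self[OF grpT] by (intro transitive_biset_data.intro) simp_all
  have "\<exists>U \<kappa> \<eta>. subgroup U ?T \<and> subgroup U S \<and> \<kappa> \<in> K P U \<and> \<eta> \<in> H U Q \<and> \<phi> = compose P \<eta> \<kappa>"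
    if P: "subgroup P ?T" and Q: "subgroup Q S" and phi: "\<phi> \<in> F P Q" for P Q \<phi>
  proof -
    have PS: "subgroup P S" using S.incl_subgroup[OF assms(6) P] .
    have PT: "P \<subseteq> T" using subgroup.subset[OF P] by simp
    have finP: "finite P" using PT finT finite_subset by auto
    note phiD = F.F_D[OF PS Q phi]
    have im: "\<phi> ` P \<subseteq> Q" using phiD(1) by auto
    have phiS: "\<phi> \<in> F P (carrier S)"
      using F.change_codomain[OF PS Q S.subgroup_self phi] im subgroup.subset[OF Q] by blast
    have phic: "\<phi> \<in> P \<rightarrow> carrier S" using F.F_D(1)[OF PS S.subgroup_self phiS] by (simp add: PiE_def)
    have nz: "mark P \<phi> ?id ?xF \<noteq> 0"
    proof -
      have "mark (\<phi> ` P) ?id ?id ?xF \<noteq> 0"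
        using F.mark_identity_nonzero[OF assms(1) S(3,2) cF(1,2)] stable aug
          F.morphism_factorization(1)[OF PS Q phi] unfolding cF(3) by blast
      moreover have "mark P \<phi> (\<lambda>q. \<phi> q) ?xF = mark P \<phi> ?id ?xF"
        using F.mark_right_stable[OF S(2) stable[unfolded cF(3) basis_comb_def] xF PS phiS finP phic,
          of ?id] by simp
      ultimately show ?thesis by (simp add: class_mark_image)
    qed
    let ?z = "Poly_Mapping.single (iso_class ?T S (transitive_biset ?T S T ?i)) 1"
    let ?u = "formal_comp ?T S S ?xF ?z"
    have z: "?z \<in> basis_elem p ?T S (carrier ?T) ?i"
      unfolding basis_elem_def using burnside_coset_self[of ?z p ?T S] by simp
    have Pid: "?id \<in> P \<rightarrow> carrier ?T" using PT by auto
    have "?xF \<in> \<omega>\<^sub>F" unfolding cF(3) basis_comb_def by (rule burnside_coset_self)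
    then have "?u \<in> burnside_comp p ?T S S \<omega>\<^sub>F (basis_elem p ?T S T ?i)"
      unfolding burnside_comp_def using z burnside_coset_self[of ?u p ?T S] by auto
    \<comment> \<open>The hypothesis on the idempotents, read as an equality of sets, supplies
      representatives on its right side: \<open>x\<close>, \<open>z'\<close> and \<open>y\<close>
      for the three factors, and \<open>w\<close> for the composite of the first two.\<close>
    then obtain w y x z' where w: "?u \<in> burnside_coset p ?T S (formal_comp ?T ?T S w y)"
      "y \<in> \<omega>\<^sub>K" "w \<in> burnside_coset p ?T S (formal_comp ?T S S x z')" "x \<in> \<omega>\<^sub>H"
      "z' \<in> basis_elem p ?T S (carrier ?T) ?i"
      unfolding assms(12) by (auto simp: burnside_comp_def)
    have x: "x \<in> burnside_coset p S S ?xH" using w(4) unfolding cH(2) basis_comb_def .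
    have y: "y \<in> burnside_coset p ?T ?T ?xK" using w(2) unfolding cK(2) basis_comb_def .
    have "Poly_Mapping.keys z' \<subseteq> biset_classes ?T S"
      by (rule keys_burnside_coset[OF w(5)[unfolded basis_elem_def]])
        (use iso_class_in_biset_classes[OF transitive_biset_data.left_free_transitive[OF dT]] in simp)
    then have kw: "Poly_Mapping.keys w \<subseteq> biset_classes ?T S"
      using keys_burnside_coset[OF w(3)] keys_formal_comp[OF grpT S(1) S(1) keys_burnside_coset[OF x xH]]
      by blast
    have ky: "Poly_Mapping.keys y \<subseteq> biset_classes ?T ?T" using keys_burnside_coset[OF y xK] .
    \<comment> \<open>Composition with \<open>[T, incl]\<close> does not change the mark, since
      \<open>P\<close> lies in \<open>T\<close>.\<close>
    have "mark P \<phi> ?id ?u = mark P \<phi> (\<lambda>q. ?i (?id q)) ?xF"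
      by (rule mark_comp_hom[OF dT S(1) finP xF phic Pid z burnside_coset_self])
    also have "\<dots> = mark P \<phi> ?id ?xF"
      using class_mark_cong[of P \<phi> \<phi> "\<lambda>q. ?i (?id q)" ?id] PT by (auto simp: subset_iff)
    finally have "mark P \<phi> ?id (formal_comp ?T ?T S w y) \<noteq> 0"
      using nz mark_burnside_coset[OF w(1) phic Pid] by simp
    then have "of_nat (card (carrier ?T)) * mark P \<phi> ?id (formal_comp ?T ?T S w y) \<noteq> 0"
      using finT assms(6) subgroup.one_closed by auto
    \<comment> \<open>The product formula over \<open>T\<close> makes a nonzero entry pass through
      some \<gamma> from \<open>P\<close> to \<open>T\<close>.\<close>
    then have "(\<Sum>\<gamma>\<in>P \<rightarrow>\<^sub>E carrier ?T. mark P \<phi> \<gamma> w * mark P \<gamma> ?id y) \<noteq> 0"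
      unfolding mark_formal_comp[OF grpT grpT S(1) finT finP kw ky phic Pid] .
    then obtain \<gamma> where \<gamma>: "\<gamma> \<in> P \<rightarrow>\<^sub>E carrier ?T" "mark P \<phi> \<gamma> w * mark P \<gamma> ?id y \<noteq> 0"
      by (rule sum.not_neutral_contains_not_neutral)
    have \<gamma>T: "\<gamma> \<in> P \<rightarrow> carrier ?T" using \<gamma>(1) by (simp add: PiE_def)
    then have \<gamma>S: "\<gamma> \<in> P \<rightarrow> carrier S" using Tsub by auto
    have "mark P \<phi> \<gamma> w = mark P \<phi> (\<lambda>q. ?i (\<gamma> q)) x"
      by (rule mark_comp_hom[OF dT S(1) finP keys_burnside_coset[OF x xH] phic \<gamma>T w(5,3)])
    also have "\<dots> = mark P \<phi> \<gamma> x"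
      using class_mark_cong[of P \<phi> \<phi> "\<lambda>q. ?i (\<gamma> q)" \<gamma>] \<gamma>T by (auto simp: Pi_iff)
    also have "\<dots> = mark P \<phi> \<gamma> ?xH" by (rule mark_burnside_coset[OF x phic \<gamma>S])
    finally have "mark P \<phi> \<gamma> ?xH \<noteq> 0" using \<gamma>(2) by simp
    \<comment> \<open>A generator of the \<open>H\<close>-idempotent expresses \<phi> in terms of
      \<gamma>.\<close>
    from mark_transitive_comb_nonzero[OF dH finP phic \<gamma>S this]
    obtain A \<eta> h g where A: "(A, \<eta>) \<in> Poly_Mapping.keys cH" "h \<in> carrier S" "g \<in> carrier S"
      "\<forall>q\<in>P. g \<otimes>\<^bsub>S\<^esub> \<gamma> q \<otimes>\<^bsub>S\<^esub> inv\<^bsub>S\<^esub> g \<in> A \<and>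
        \<phi> q = h \<otimes>\<^bsub>S\<^esub> \<eta> (g \<otimes>\<^bsub>S\<^esub> \<gamma> q \<otimes>\<^bsub>S\<^esub> inv\<^bsub>S\<^esub> g) \<otimes>\<^bsub>S\<^esub> inv\<^bsub>S\<^esub> h"
      by blast
    have "mark P \<gamma> ?id ?xK \<noteq> 0"
      using \<gamma>(2) mark_burnside_coset[OF y \<gamma>T Pid] by simp
    from mark_transitive_comb_nonzero[OF dK finP \<gamma>T Pid this]
    obtain B \<kappa> h' g' where B: "(B, \<kappa>) \<in> Poly_Mapping.keys cK" "h' \<in> carrier ?T" "g' \<in> carrier ?T"
      "\<forall>q\<in>P. g' \<otimes>\<^bsub>?T\<^esub> q \<otimes>\<^bsub>?T\<^esub> inv\<^bsub>?T\<^esub> g' \<in> B \<and>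
        \<gamma> q = h' \<otimes>\<^bsub>?T\<^esub> \<kappa> (g' \<otimes>\<^bsub>?T\<^esub> q \<otimes>\<^bsub>?T\<^esub> inv\<^bsub>?T\<^esub> g') \<otimes>\<^bsub>?T\<^esub> inv\<^bsub>?T\<^esub> h'"
      by blast
    \<comment> \<open>The generator \<kappa> of the \<open>K\<close>-idempotent and two conjugations
      by elements of \<open>T\<close> compose to \<gamma>.\<close>
    have "\<gamma> \<in> K P (carrier ?T)"
    proof (rule K.conj_conj_in_F[OF P])
      show "subgroup B ?T" "\<kappa> \<in> K B (carrier ?T)" using cK(1) B(1) by auto
      show "\<gamma> \<in> extensional P" using \<gamma>(1) by (simp add: PiE_def)
    qed (use B in blast)+
    note \<gamma>K = K.morphism_factorization[OF P group.subgroup_self[OF grpT] this]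
    let ?U = "\<gamma> ` P"
    have US: "subgroup ?U S" using S.incl_subgroup[OF assms(6) \<gamma>K(1)] .
    \<comment> \<open>The relation between \<phi> and \<gamma> depends on \<open>q\<close> only
      through \<open>\<gamma> q\<close>, so it defines a map on the image of \<gamma>; this image is
      the intermediate object.\<close>
    let ?\<eta> = "\<lambda>u\<in>?U. h \<otimes>\<^bsub>S\<^esub> \<eta> (g \<otimes>\<^bsub>S\<^esub> u \<otimes>\<^bsub>S\<^esub> inv\<^bsub>S\<^esub> g) \<otimes>\<^bsub>S\<^esub> inv\<^bsub>S\<^esub> h"
    have "?\<eta> \<in> H ?U (carrier S)"
    proof (rule H.conj_conj_in_F[OF US])
      show "subgroup A S" "\<eta> \<in> H A (carrier S)" using cH(1) A(1) by auto
    qed (use A in auto)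
    moreover have "?\<eta> ` ?U \<subseteq> Q" using A(4) im by auto
    ultimately have "?\<eta> \<in> H ?U Q" by (rule H.change_codomain[OF US S.subgroup_self Q])
    moreover have "\<phi> = compose P ?\<eta> \<gamma>"
      by (rule extensionalityI[of _ P]) (use phiD(1) A(4) in \<open>auto simp: compose_def PiE_def\<close>)
    ultimately show ?thesis using \<gamma>K(1,2) US by blast
  qed
  moreover have "carrier S = carrier S <#>\<^bsub>S\<^esub> T"
  proof
    show "carrier S \<subseteq> carrier S <#>\<^bsub>S\<^esub> T"
    proof
      fix s assume "s \<in> carrier S"
      then show "s \<in> carrier S <#>\<^bsub>S\<^esub> T"
        using subgroup.one_closed[OF assms(6)] S.r_one[of s] unfolding set_mult_def by force
    qed
    show "carrier S <#>\<^bsub>S\<^esub> T \<subseteq> carrier S" using Tsub by (auto simp: set_mult_def)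
  qed
  ultimately show ?thesis unfolding composition_product_def by simp
qed

end
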